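(* Let $\phi:[0,1]\to\mathbb{R}$ be differentiable with bounded derivative, and let $g$ be a local function of configurations with dependence set $\{1,\dots,k\}$, $k\in\mathbb{N}$, $k\ge1$. Assume that there exist $B(\theta_L,\theta_R)\in\mathbb{R}$ and $\epsilon>0$ such that for all $N\ge k$, all $i\in\{0,1,\dots,N-k\}$ and all $\theta=(\theta_1,\dots,\theta_N)$ with $\theta_L\le\theta_1\le\theta_2\le\dots\le\theta_N<\theta_R$ the following two conditions hold: (i) with $Y_{i,N}:=(\tau_i g)[\eta]-\mathbb{E}[(\tau_i g)[\eta]\mid\Theta=\theta]$, $$\mathbb{E}\big[|Y_{i,N}|^{2+\epsilon}\,\big|\,\Theta=\theta\big]\le B(\theta_L,\theta_R)<\infty;$$ (ii) $\mathbb{E}[g(\eta)\mid\Theta=\theta]\le B(\theta_L,\theta_R)<\infty$. Then $$X_N(g;\phi):=\frac1N\sum_{i=0}^{N-k}(\tau_i g)[\eta]\,\phi\Big(\frac{i}{N+1}\Big)\ \longrightarrow\ \int_0^1 h(\rho_{\theta_L,\theta_R}(x))\,\phi(x)\,dx$$ almost surely as $N\to\infty$, where $h:[\theta_L,\theta_R]\to\mathbb{R}$ is defined by $h(\rho)=\mathbb{E}[g(\eta)\mid\Theta=(\rho,\rho,\dots,\rho)]$.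
   Context: $\mathbb{N}=\{0,1,2,\dots\}$. For $\theta\in[0,\infty)$, $\nu_\theta$ is the geometric distribution on $\mathbb{N}$ with mean $\theta$: $\nu_\theta(n)=\frac{1}{1+\theta}\big(\frac{\theta}{1+\theta}\big)^n$. Fix $0\le\theta_L<\theta_R$ and set $\rho_{\theta_L,\theta_R}(x)=\theta_L+(\theta_R-\theta_L)x$ for $x\in[0,1]$. For each $N\ge1$, let $\Theta=(\Theta_{1,N},\dots,\Theta_{N,N})$ be the order statistics (in non-decreasing order) of $N$ independent random variables uniformly distributed on $[\theta_L,\theta_R]$. The random configuration $\eta=(\eta_{1,N},\dots,\eta_{N,N})\in\mathbb{N}^N$ is such that, conditionally on $\Theta=(\theta_1,\dots,\theta_N)$, its law is $\otimes_{i=1}^N\nu_{\theta_i}$; expectations $\mathbb{E}[\,\cdot\mid\Theta=\theta]$ are expectations under $\otimes_{i=1}^N\nu_{\theta_i}$. The random variables $\eta_{i,N},\Theta_{i,N}$ are regarded as defined on a common probability space jointly for all $N$. A local function with dependence set $\{1,\dots,k\}$ is a function $g:\mathbb{N}^N\to\mathbb{R}$ ($N\ge k$) depending only on the first $k$ coordinates, i.e. a fixed function $g(\eta)=g(\eta_1,\dots,\eta_k)$, the same for all $N\ge k$. The shift is $(\tau_i g)[\eta]=g(\eta_{i+1},\dots,\eta_{i+k})$. *)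

theory Defs
  imports "HOL-Probability.Probability" "HOL-Probability.Product_PMF"
begin

definition nu :: "real \<Rightarrow> nat pmf" where
  "nu \<theta> = geometric_pmf (1 / (1 + \<theta>))"

lemma pmf_nu:
  assumes "\<theta> \<ge> 0"
  shows "pmf (nu \<theta>) n = 1 / (1 + \<theta>) * (\<theta> / (1 + \<theta>)) ^ n"
proof -
  have "1 - 1 / (1 + \<theta>) = \<theta> / (1 + \<theta>)"
    using assms by (simp add: field_simps)
  then show ?thesis
    using assms by (simp add: nu_def pmf_geometric)
qed

text \<open>
  An element of \<open>\<nat>\<^sup>N\<close> is a function \<open>nat \<Rightarrow> nat\<close> of which only the coordinates in \<open>{1..N}\<close>
  matter; the product law below puts \<open>0\<close> at all other coordinates.
\<close>

definition config_law :: "nat \<Rightarrow> (nat \<Rightarrow> real) \<Rightarrow> (nat \<Rightarrow> nat) pmf" where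
  "config_law N \<theta> = Pi_pmf {1..N} 0 (\<lambda>i. nu (\<theta> i))"

definition order_stat :: "nat \<Rightarrow> (nat \<Rightarrow> real) \<Rightarrow> nat \<Rightarrow> real" where
  "order_stat N u i = sort (map u [1..<Suc N]) ! (i - 1)"

definition uniform_order_stats_law :: "real \<Rightarrow> real \<Rightarrow> nat \<Rightarrow> (nat \<Rightarrow> real) measure" where
  "uniform_order_stats_law a b N =
     distr (PiM {1..N} (\<lambda>_. uniform_measure lborel {a..b})) (PiM {1..N} (\<lambda>_. borel))
       (\<lambda>u. \<lambda>i\<in>{1..N}. order_stat N u i)"

definition vec_law :: "'a measure \<Rightarrow> nat \<Rightarrow> (nat \<Rightarrow> 'a \<Rightarrow> real) \<Rightarrow> (nat \<Rightarrow> real) measure" where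
  "vec_law M N T = distr M (PiM {1..N} (\<lambda>_. borel)) (\<lambda>\<omega>. \<lambda>i\<in>{1..N}. T i \<omega>)"

definition vec_algebra :: "'a measure \<Rightarrow> nat \<Rightarrow> (nat \<Rightarrow> 'a \<Rightarrow> real) \<Rightarrow> 'a measure" where
  "vec_algebra M N T =
     vimage_algebra (space M) (\<lambda>\<omega>. \<lambda>i\<in>{1..N}. T i \<omega>) (PiM {1..N} (\<lambda>_. borel))"

text \<open>
  Conditionally on \<open>T = (T\<^sub>1, \<dots>, T\<^sub>N)\<close>, the vector \<open>(e\<^sub>1, \<dots>, e\<^sub>N)\<close> has the product law with
  parameters \<open>T\<close>.  The space of configurations being countable, every set \<open>C\<close> is an event.
\<close>

definition conditional_config_law ::
  "'a measure \<Rightarrow> nat \<Rightarrow> (nat \<Rightarrow> 'a \<Rightarrow> real) \<Rightarrow> (nat \<Rightarrow> 'a \<Rightarrow> nat) \<Rightarrow> bool" where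
  "conditional_config_law M N T e \<longleftrightarrow>
     (\<forall>C. AE \<omega> in M.
        real_cond_exp M (vec_algebra M N T)
          (indicat_real {\<omega>\<in>space M. (\<lambda>i. if i \<in> {1..N} then e i \<omega> else 0) \<in> C}) \<omega>
        = measure_pmf.prob (config_law N (\<lambda>i. T i \<omega>)) C)"

definition local_function :: "nat \<Rightarrow> ((nat \<Rightarrow> nat) \<Rightarrow> real) \<Rightarrow> bool" where
  "local_function k g \<longleftrightarrow>
     (\<forall>\<eta> \<eta>'. (\<forall>j\<in>{1..k}. \<eta> j = \<eta>' j) \<longrightarrow> g \<eta> = g \<eta>')"

definition tau :: "nat \<Rightarrow> ((nat \<Rightarrow> nat) \<Rightarrow> real) \<Rightarrow> (nat \<Rightarrow> nat) \<Rightarrow> real" where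
  "tau i g \<eta> = g (\<lambda>j. \<eta> (i + j))"

definition rho :: "real \<Rightarrow> real \<Rightarrow> real \<Rightarrow> real" where
  "rho \<theta>\<^sub>L \<theta>\<^sub>R x = \<theta>\<^sub>L + (\<theta>\<^sub>R - \<theta>\<^sub>L) * x"

text \<open>
  \<open>E[f(\<eta>) | \<Theta> = \<theta>]\<close>.
\<close>

definition cexp :: "nat \<Rightarrow> (nat \<Rightarrow> real) \<Rightarrow> ((nat \<Rightarrow> nat) \<Rightarrow> real) \<Rightarrow> real" where
  "cexp N \<theta> f = measure_pmf.expectation (config_law N \<theta>) f"

text \<open>
  For a local function with dependence set \<open>{1..k}\<close> every length \<open>N \<ge> k\<close> of the constant
  parameter vector gives the same value; \<open>N = k\<close> is used.
\<close>

definition h_fun :: "nat \<Rightarrow> ((nat \<Rightarrow> nat) \<Rightarrow> real) \<Rightarrow> real \<Rightarrow> real" where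
  "h_fun k g r = cexp k (\<lambda>_. r) g"

definition X_fun ::
  "nat \<Rightarrow> ((nat \<Rightarrow> nat) \<Rightarrow> real) \<Rightarrow> (real \<Rightarrow> real) \<Rightarrow> nat \<Rightarrow> (nat \<Rightarrow> nat) \<Rightarrow> real" where
  "X_fun k g \<phi> N \<eta> = 1 / real N * (\<Sum>i=0..N - k. tau i g \<eta> * \<phi> (real i / real (N + 1)))"

end

theory Submission
  imports Defs
begin

text \<open>
  Conditionally on \<open>\<Theta>\<close>, the summands of \<open>X\<^sub>N\<close> split into \<open>k\<close> classes of independent variables
  according to the residue of the index modulo \<open>k\<close>.  Truncation at level \<open>N\<close> and fourth moments bound
  the probability of a deviation of \<open>X\<^sub>N\<close> from its conditional mean by \<open>C * N powr (1 - p)\<close> with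
  \<open>p > 2\<close>, uniformly in the parameters, so the deviation tends to \<open>0\<close> almost surely by Borel--Cantelli.
  The same tail bound applied to the empirical distribution function of the uniform sample shows that
  almost surely \<open>\<Theta>\<^sub>i\<close> is close to \<open>rho\<close> at \<open>i / N\<close>.  The conditional mean is then the integral of a
  step function, whose limit is found by dominated convergence: the mean of \<open>g\<close> is bounded on ordered
  parameters and continuous at constant ones, because \<open>nu s\<close> is dominated by \<open>(1 + t - s) * nu t\<close> for
  \<open>s \<le> t\<close>.
\<close>

section \<open>Deviations of sums of independent variables\<close>

text \<open>Two limitations shape the argument. The hypotheses control moments of order slightly
  above 2 only: Chebyshev's inequality then gives the rate \<open>1 / N\<close>, which is not
  summable, and fourth moments of the summands may be infinite, hence the truncation. Moreover,
  nothing is assumed about the dependence between different system sizes, so there is no single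
  infinite independent sequence to which a strong law could be applied; summable probabilities,
  computed separately for each \<open>N\<close>, are enough for the first Borel--Cantelli lemma.

  On the side of the means, (ii) gives an upper bound only; the two-sided bound required for
  dominated convergence has to be extracted from (i). Finally, geometric densities compare in one
  direction only: the ratio of the density at a larger parameter to that at a smaller one is
  unbounded. Continuity of the mean is therefore obtained by comparing both parameter vectors with a
  common larger constant vector.\<close>

lemma (in prob_space) integrable_real_bounded:
  fixes f :: "'a \<Rightarrow> real"
  assumes "f \<in> borel_measurable M" "\<And>\<omega>. \<omega> \<in> space M \<Longrightarrow> \<bar>f \<omega>\<bar> \<le> K"
  shows "integrable M f"
  using assms by (intro integrable_const_bound[where B = K]) auto

lemma (in prob_space) integrable_power_bounded:
  fixes f :: "'a \<Rightarrow> real"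
  assumes "f \<in> borel_measurable M" "\<And>\<omega>. \<omega> \<in> space M \<Longrightarrow> \<bar>f \<omega>\<bar> \<le> K"
  shows "integrable M (\<lambda>\<omega>. (f \<omega>) ^ n)"
  using assms by (intro integrable_real_bounded[where K = "K ^ n"])
    (simp_all add: power_abs power_mono)

lemma (in prob_space) square_expectation_le:
  fixes f :: "'a \<Rightarrow> real"
  assumes "integrable M f" "integrable M (\<lambda>\<omega>. (f \<omega>)\<^sup>2)"
  shows "(expectation f)\<^sup>2 \<le> expectation (\<lambda>\<omega>. (f \<omega>)\<^sup>2)"
  using variance_eq[OF assms] variance_positive[of f] by simp

lemma (in prob_space) indep_var_expectation_mult:
  fixes X Y :: "'a \<Rightarrow> real"
  assumes "indep_var borel X borel Y" "f \<in> borel_measurable borel" "h \<in> borel_measurable borel"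
    and "integrable M (\<lambda>\<omega>. f (X \<omega>))" "integrable M (\<lambda>\<omega>. h (Y \<omega>))"
  shows "expectation (\<lambda>\<omega>. f (X \<omega>) * h (Y \<omega>) :: real)
    = expectation (\<lambda>\<omega>. f (X \<omega>)) * expectation (\<lambda>\<omega>. h (Y \<omega>))"
  using indep_var_lebesgue_integral[OF indep_var_compose[OF assms(1-3)]] assms(4,5)
  by (simp add: comp_def)

text \<open>When an independent centred \<open>Z\<close> is added to the sum \<open>S\<close> of
  \<open>n\<close> earlier summands, \<open>Z * S ^ 3\<close> and \<open>Z ^ 3 * S\<close> have mean
  zero, and the surviving cross term is at most \<open>6 * s * (n * s)\<close>, which fits because
  \<open>3 * n^2 + 6 * n \<le> 3 * (n + 1)^2\<close>. Both bounds run through one induction since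
  the fourth moment step calls on the second moment of \<open>S\<close>. The bound \<open>K\<close>
  secures integrability and stays out of the estimate.\<close>

lemma (in prob_space) fourth_moment_indep_sum:
  fixes Z :: "'i \<Rightarrow> 'a \<Rightarrow> real" and s q K :: real
  assumes "finite I" "indep_vars (\<lambda>_. borel) Z I"
    and bnd: "\<And>i \<omega>. i \<in> I \<Longrightarrow> \<omega> \<in> space M \<Longrightarrow> \<bar>Z i \<omega>\<bar> \<le> K"
    and mean: "\<And>i. i \<in> I \<Longrightarrow> expectation (Z i) = 0"
    and second: "\<And>i. i \<in> I \<Longrightarrow> expectation (\<lambda>\<omega>. (Z i \<omega>)\<^sup>2) \<le> s"
    and fourth: "\<And>i. i \<in> I \<Longrightarrow> expectation (\<lambda>\<omega>. (Z i \<omega>) ^ 4) \<le> q"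
  shows "expectation (\<lambda>\<omega>. (\<Sum>i\<in>I. Z i \<omega>)\<^sup>2) \<le> card I * s
    \<and> expectation (\<lambda>\<omega>. (\<Sum>i\<in>I. Z i \<omega>) ^ 4) \<le> card I * q + 3 * (real (card I))\<^sup>2 * s\<^sup>2"
  using assms
proof (induction I rule: finite_induct)
  case empty
  then show ?case by simp
next
  case (insert i I)
  define S where "S \<omega> = (\<Sum>j\<in>I. Z j \<omega>)" for \<omega>
  have IH: "expectation (\<lambda>\<omega>. (S \<omega>)\<^sup>2) \<le> card I * s"
    "expectation (\<lambda>\<omega>. (S \<omega>) ^ 4) \<le> card I * q + 3 * (real (card I))\<^sup>2 * s\<^sup>2"
    using insert.IH indep_vars_subset[OF insert.prems(1)] insert.prems by (auto simp: S_def)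
  have ind: "indep_var borel (Z i) borel S"
    unfolding S_def using indep_vars_sum[OF insert.hyps insert.prems(1)] by simp
  have Zm: "Z j \<in> borel_measurable M" if "j \<in> insert i I" for j
    using insert.prems(1) that by (auto simp: indep_vars_def)
  have [measurable]: "Z i \<in> borel_measurable M" "S \<in> borel_measurable M"
    using Zm unfolding S_def by auto
  have Sb: "\<bar>S \<omega>\<bar> \<le> card I * K" if "\<omega> \<in> space M" for \<omega>
    using sum_norm_bound[of I "\<lambda>j. Z j \<omega>" K] insert.prems(2) that by (auto simp: S_def)
  have Zi: "integrable M (\<lambda>\<omega>. (Z i \<omega>) ^ n)" for n
    by (rule integrable_power_bounded[where K = K]) (auto intro: insert.prems(2))
  have Si: "integrable M (\<lambda>\<omega>. (S \<omega>) ^ n)" for n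
    by (rule integrable_power_bounded[OF _ Sb]) auto
  have prodi: "integrable M (\<lambda>\<omega>. (Z i \<omega>) ^ m * (S \<omega>) ^ n)" for m n
    by (rule integrable_real_bounded[where K = "K ^ m * (card I * K) ^ n"])
      (auto simp: power_abs abs_mult intro!: mult_mono power_mono Sb insert.prems(2) zero_le_power
        order_trans[OF abs_ge_zero insert.prems(2)[of i]] mult_nonneg_nonneg)
  have prodE: "expectation (\<lambda>\<omega>. (Z i \<omega>) ^ m * (S \<omega>) ^ n)
      = expectation (\<lambda>\<omega>. (Z i \<omega>) ^ m) * expectation (\<lambda>\<omega>. (S \<omega>) ^ n)" for m n
    by (rule indep_var_expectation_mult[OF ind]) (use Zi Si in auto)
  have ES: "expectation S = 0"
    unfolding S_def using insert.prems(2,3) Zm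
    by (subst Bochner_Integration.integral_sum)
      (auto intro!: integrable_real_bounded[where K = K] sum.neutral)
  have EZ: "expectation (Z i) = 0"
    using insert.prems(3) by simp
  have s0: "0 \<le> expectation (\<lambda>\<omega>. (Z i \<omega>)\<^sup>2)" "0 \<le> expectation (\<lambda>\<omega>. (S \<omega>)\<^sup>2)"
    by (auto intro: Bochner_Integration.integral_nonneg)
  then have "0 \<le> s"
    using insert.prems(4)[of i] by (meson insertI1 order_trans)
  have Z2: "expectation (\<lambda>\<omega>. (Z i \<omega>)\<^sup>2) \<le> s" and Z4: "expectation (\<lambda>\<omega>. (Z i \<omega>) ^ 4) \<le> q"
    using insert.prems(4,5) by auto
  have sum_eq: "(\<Sum>j\<in>insert i I. Z j \<omega>) = Z i \<omega> + S \<omega>" for \<omega>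
    using insert.hyps by (simp add: S_def)
  have "expectation (\<lambda>\<omega>. (Z i \<omega> + S \<omega>)\<^sup>2)
      = expectation (\<lambda>\<omega>. (Z i \<omega>)\<^sup>2 + (2 * ((Z i \<omega>) ^ 1 * (S \<omega>) ^ 1) + (S \<omega>)\<^sup>2))"
    by (intro Bochner_Integration.integral_cong) (auto simp: power2_eq_square algebra_simps)
  also have "\<dots> = expectation (\<lambda>\<omega>. (Z i \<omega>)\<^sup>2)
      + (2 * expectation (\<lambda>\<omega>. (Z i \<omega>) ^ 1 * (S \<omega>) ^ 1) + expectation (\<lambda>\<omega>. (S \<omega>)\<^sup>2))"
    using Zi[of 2] Si[of 2] prodi[of 1 1]
    by (simp only: Bochner_Integration.integral_add Bochner_Integration.integrable_add
        integrable_mult_right integral_mult_right_zero simp_thms)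
  also have "\<dots> = expectation (\<lambda>\<omega>. (Z i \<omega>)\<^sup>2) + expectation (\<lambda>\<omega>. (S \<omega>)\<^sup>2)"
    unfolding prodE using EZ by simp
  finally have 2: "expectation (\<lambda>\<omega>. (Z i \<omega> + S \<omega>)\<^sup>2) \<le> (1 + card I) * s"
    using Z2 IH(1) by (simp add: algebra_simps)
  have "expectation (\<lambda>\<omega>. (Z i \<omega> + S \<omega>) ^ 4)
      = expectation (\<lambda>\<omega>. (Z i \<omega>) ^ 4 + (4 * ((Z i \<omega>) ^ 3 * (S \<omega>) ^ 1)
          + (6 * ((Z i \<omega>) ^ 2 * (S \<omega>) ^ 2) + (4 * ((Z i \<omega>) ^ 1 * (S \<omega>) ^ 3) + (S \<omega>) ^ 4))))"
    by (intro Bochner_Integration.integral_cong)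
      (auto simp: power4_eq_xxxx power3_eq_cube power2_eq_square algebra_simps)
  also have "\<dots> = expectation (\<lambda>\<omega>. (Z i \<omega>) ^ 4) + (4 * expectation (\<lambda>\<omega>. (Z i \<omega>) ^ 3 * (S \<omega>) ^ 1)
      + (6 * expectation (\<lambda>\<omega>. (Z i \<omega>) ^ 2 * (S \<omega>) ^ 2)
      + (4 * expectation (\<lambda>\<omega>. (Z i \<omega>) ^ 1 * (S \<omega>) ^ 3) + expectation (\<lambda>\<omega>. (S \<omega>) ^ 4))))"
    using Zi[of 4] Si[of 4] prodi[of 3 1] prodi[of 2 2] prodi[of 1 3]
    by (simp only: Bochner_Integration.integral_add Bochner_Integration.integrable_add
        integrable_mult_right integral_mult_right_zero simp_thms)
  also have "\<dots> = expectation (\<lambda>\<omega>. (Z i \<omega>) ^ 4)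
      + (6 * (expectation (\<lambda>\<omega>. (Z i \<omega>)\<^sup>2) * expectation (\<lambda>\<omega>. (S \<omega>)\<^sup>2)) + expectation (\<lambda>\<omega>. (S \<omega>) ^ 4))"
    unfolding prodE using EZ ES by simp
  also have "\<dots> \<le> q + (6 * (s * (card I * s)) + (card I * q + 3 * (real (card I))\<^sup>2 * s\<^sup>2))"
    using Z4 IH(2) mult_mono[OF Z2 IH(1)] s0 \<open>0 \<le> s\<close> by (intro add_mono mult_left_mono) auto
  also have "\<dots> \<le> (1 + card I) * q + 3 * (1 + real (card I))\<^sup>2 * s\<^sup>2"
    by (simp add: power2_eq_square algebra_simps)
  finally show ?case
    using 2 insert.hyps unfolding sum_eq by simp
qed

lemma square_le_one_plus_powr:
  fixes y :: real
  assumes "2 \<le> p"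
  shows "y\<^sup>2 \<le> 1 + \<bar>y\<bar> powr p"
proof (cases "\<bar>y\<bar> \<le> 1")
  case True
  then have "y\<^sup>2 \<le> 1" by (simp add: abs_square_le_1)
  then show ?thesis by (simp add: add_increasing2)
next
  case False
  then have "\<bar>y\<bar> powr 2 \<le> \<bar>y\<bar> powr p"
    using assms by (intro powr_mono) auto
  then show ?thesis using False by simp
qed

lemma fourth_power_add_le: "(a + b) ^ 4 \<le> 8 * (a ^ 4 + b ^ 4)" for a b :: real
proof -
  have sq: "(x + y)\<^sup>2 \<le> 2 * (x\<^sup>2 + y\<^sup>2)" for x y :: real
    using sum_squares_bound[of x y] by (simp add: power2_sum)
  have "((a + b)\<^sup>2)\<^sup>2 \<le> (2 * (a\<^sup>2 + b\<^sup>2))\<^sup>2"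
    by (intro power_mono sq) auto
  also have "\<dots> \<le> 4 * (2 * ((a\<^sup>2)\<^sup>2 + (b\<^sup>2)\<^sup>2))"
    unfolding power_mult_distrib using sq[of "a\<^sup>2" "b\<^sup>2"] by simp
  finally show ?thesis by simp
qed

text \<open>
  Truncating at level \<open>N\<close> costs \<open>N * N powr - p\<close> in probability and brings the fourth moment of each
  summand down to order \<open>N powr (4 - p)\<close>; both are summable contributions because \<open>p > 2\<close>.
\<close>

lemma (in prob_space) indep_sum_deviation:
  fixes Y :: "'i \<Rightarrow> 'a \<Rightarrow> real" and N :: nat and p B \<delta> :: real
  assumes I: "finite I" "card I \<le> N" and ind: "indep_vars (\<lambda>_. borel) Y I"
    and Yi: "\<And>i. i \<in> I \<Longrightarrow> integrable M (Y i)"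
    and mean: "\<And>i. i \<in> I \<Longrightarrow> expectation (Y i) = 0"
    and pi: "\<And>i. i \<in> I \<Longrightarrow> integrable M (\<lambda>\<omega>. \<bar>Y i \<omega>\<bar> powr p)"
    and pB: "\<And>i. i \<in> I \<Longrightarrow> expectation (\<lambda>\<omega>. \<bar>Y i \<omega>\<bar> powr p) \<le> B"
    and p: "2 \<le> p" "p \<le> 3" and B: "0 \<le> B" and \<delta>: "0 < \<delta>" and N: "0 < N" "2 * (1 + B) \<le> \<delta> * N"
  shows "prob {\<omega> \<in> space M. \<delta> * N < \<bar>\<Sum>i\<in>I. Y i \<omega>\<bar>}
    \<le> (B + (2 / \<delta>) ^ 4 * (16 * B + 3 * (1 + B)\<^sup>2)) * N powr (1 - p)"
proof -
  have Ym: "Y i \<in> borel_measurable M" if "i \<in> I" for i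
    using Yi that by auto
  \<comment> \<open>Values beyond \<open>N\<close> become 0, so a truncated summand equals the
    original one wherever the latter is at most \<open>N\<close> in absolute value.\<close>
  define tr where "tr y = (if \<bar>y\<bar> \<le> real N then y else 0)" for y :: real
  have [measurable]: "tr \<in> borel_measurable borel" unfolding tr_def by measurable
  define W where "W i \<omega> = tr (Y i \<omega>)" for i \<omega>
  \<comment> \<open>Truncation may spoil the vanishing mean, so the summands are recentred; the bias
    is estimated separately in \<open>EW\<close>.\<close>
  define Z where "Z i \<omega> = W i \<omega> - expectation (W i)" for i \<omega>
  have Wm: "W i \<in> borel_measurable M" if "i \<in> I" for i
    unfolding W_def using Ym[OF that] by measurable
  have Wb: "\<bar>W i \<omega>\<bar> \<le> N" for i \<omega> by (simp add: W_def tr_def)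
  have Wi: "integrable M (\<lambda>\<omega>. (W i \<omega>) ^ n)" if "i \<in> I" for i n
    by (rule integrable_power_bounded[OF Wm[OF that] Wb])
  have Wi1: "integrable M (W i)" if "i \<in> I" for i
    using Wi[OF that, of 1] by simp
  have EWb: "\<bar>expectation (W i)\<bar> \<le> N" if "i \<in> I" for i
  proof -
    have "\<bar>expectation (W i)\<bar> \<le> expectation (\<lambda>\<omega>. \<bar>W i \<omega>\<bar>)"
      using integral_abs_bound by blast
    also have "\<dots> \<le> expectation (\<lambda>\<omega>. real N)"
      using Wi1[OF that] by (intro integral_mono) (auto simp: Wb)
    finally show ?thesis by (simp add: prob_space)
  qed
  have Zind: "indep_vars (\<lambda>_. borel) Z I"
    unfolding Z_def W_def by (rule indep_vars_compose2[OF ind]) measurable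
  have Zm: "Z i \<in> borel_measurable M" if "i \<in> I" for i
    unfolding Z_def using Wm[OF that] by measurable
  have Zb: "\<bar>Z i \<omega>\<bar> \<le> 2 * N" if "i \<in> I" for i \<omega>
    using EWb[OF that] Wb[of i \<omega>] unfolding Z_def by linarith
  have Ysq: "integrable M (\<lambda>\<omega>. (Y i \<omega>)\<^sup>2)" "expectation (\<lambda>\<omega>. (Y i \<omega>)\<^sup>2) \<le> 1 + B" if "i \<in> I" for i
  proof -
    have I1: "integrable M (\<lambda>\<omega>. 1 + \<bar>Y i \<omega>\<bar> powr p)" using pi[OF that] by simp
    show 1: "integrable M (\<lambda>\<omega>. (Y i \<omega>)\<^sup>2)"
      by (rule Bochner_Integration.integrable_bound[OF I1])
        (use Ym[OF that] square_le_one_plus_powr[OF p(1)] in \<open>auto intro!: AE_I2\<close>)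
    have "expectation (\<lambda>\<omega>. (Y i \<omega>)\<^sup>2) \<le> expectation (\<lambda>\<omega>. 1 + \<bar>Y i \<omega>\<bar> powr p)"
      by (intro integral_mono 1 I1 square_le_one_plus_powr p)
    also have "\<dots> \<le> 1 + B" using pi[OF that] pB[OF that] by (simp add: prob_space)
    finally show "expectation (\<lambda>\<omega>. (Y i \<omega>)\<^sup>2) \<le> 1 + B" .
  qed
  \<comment> \<open>Where the truncation acts, \<open>N < \<bar>Y\<bar>\<close> and hence
    \<open>\<bar>Y\<bar> \<le> Y^2 / N\<close>. Summed over at most \<open>N\<close> indices, the
    bias is at most \<open>1 + B\<close>, which the assumption on \<open>\<delta> * N\<close> keeps
    within half of the threshold.\<close>
  have EW: "\<bar>expectation (W i)\<bar> \<le> (1 + B) / N" if "i \<in> I" for i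
  proof -
    have "expectation (W i) = expectation (\<lambda>\<omega>. W i \<omega> - Y i \<omega>)"
      using Wi1[OF that] Yi[OF that] mean[OF that] by simp
    then have "\<bar>expectation (W i)\<bar> \<le> expectation (\<lambda>\<omega>. \<bar>W i \<omega> - Y i \<omega>\<bar>)"
      using integral_abs_bound by metis
    also have "\<dots> \<le> expectation (\<lambda>\<omega>. (Y i \<omega>)\<^sup>2 / N)"
    proof (intro integral_mono)
      show "integrable M (\<lambda>\<omega>. \<bar>W i \<omega> - Y i \<omega>\<bar>)" using Wi1[OF that] Yi[OF that] by auto
      show "integrable M (\<lambda>\<omega>. (Y i \<omega>)\<^sup>2 / N)" using Ysq[OF that] by auto
      show "\<bar>W i \<omega> - Y i \<omega>\<bar> \<le> (Y i \<omega>)\<^sup>2 / N" for \<omega>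
      proof (cases "\<bar>Y i \<omega>\<bar> \<le> N")
        case False
        then have "\<bar>Y i \<omega>\<bar> * N \<le> \<bar>Y i \<omega>\<bar> * \<bar>Y i \<omega>\<bar>" by (intro mult_left_mono) auto
        then show ?thesis using False N by (simp add: W_def tr_def field_simps power2_eq_square)
      qed (auto simp: W_def tr_def)
    qed
    also have "\<dots> \<le> (1 + B) / N" using Ysq[OF that] by (simp add: divide_right_mono)
    finally show ?thesis .
  qed
  have W4: "expectation (\<lambda>\<omega>. (W i \<omega>) ^ 4) \<le> N powr (4 - p) * B" if "i \<in> I" for i
  proof -
    have "expectation (\<lambda>\<omega>. (W i \<omega>) ^ 4) \<le> expectation (\<lambda>\<omega>. N powr (4 - p) * \<bar>Y i \<omega>\<bar> powr p)"
    proof (intro integral_mono Wi that)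
      show "integrable M (\<lambda>\<omega>. N powr (4 - p) * \<bar>Y i \<omega>\<bar> powr p)" using pi[OF that] by simp
      \<comment> \<open>Of the four powers, \<open>4 - p\<close> are paid for with \<open>N\<close>;
        the others form the moment that is bounded by hypothesis.\<close>
      show "(W i \<omega>) ^ 4 \<le> N powr (4 - p) * \<bar>Y i \<omega>\<bar> powr p" for \<omega>
      proof (cases "\<bar>Y i \<omega>\<bar> \<le> N \<and> Y i \<omega> \<noteq> 0")
        case True
        then have "(W i \<omega>) ^ 4 = \<bar>Y i \<omega>\<bar> powr ((4 - p) + p)"
          by (simp add: W_def tr_def power_even_abs)
        also have "\<dots> = \<bar>Y i \<omega>\<bar> powr (4 - p) * \<bar>Y i \<omega>\<bar> powr p" by (rule powr_add)
        also have "\<dots> \<le> N powr (4 - p) * \<bar>Y i \<omega>\<bar> powr p"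
          using True p by (intro mult_right_mono powr_mono2) auto
        finally show ?thesis .
      qed (auto simp: W_def tr_def)
    qed
    also have "\<dots> \<le> N powr (4 - p) * B" using pB[OF that] by (simp add: mult_left_mono)
    finally show ?thesis .
  qed
  have Z2: "expectation (\<lambda>\<omega>. (Z i \<omega>)\<^sup>2) \<le> 1 + B" if "i \<in> I" for i
  proof -
    have "expectation (\<lambda>\<omega>. (Z i \<omega>)\<^sup>2) \<le> expectation (\<lambda>\<omega>. (W i \<omega>)\<^sup>2)"
      unfolding Z_def using variance_eq[OF Wi1[OF that] Wi[OF that]] by simp
    also have "\<dots> \<le> expectation (\<lambda>\<omega>. (Y i \<omega>)\<^sup>2)"
      by (intro integral_mono Wi Ysq that) (auto simp: W_def tr_def)
    also have "\<dots> \<le> 1 + B" by (rule Ysq[OF that])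
    finally show ?thesis .
  qed
  \<comment> \<open>Jensen's inequality, applied twice to the square, bounds the fourth power of the
    mean by the fourth moment. The factor 16 is the 8 of \<open>fourth_power_add_le\<close> times
    two equal contributions.\<close>
  have Z4: "expectation (\<lambda>\<omega>. (Z i \<omega>) ^ 4) \<le> 16 * (N powr (4 - p) * B)" if "i \<in> I" for i
  proof -
    have "((expectation (W i))\<^sup>2)\<^sup>2 \<le> (expectation (\<lambda>\<omega>. (W i \<omega>)\<^sup>2))\<^sup>2"
      by (intro power_mono square_expectation_le Wi1 Wi that) auto
    also have "\<dots> \<le> expectation (\<lambda>\<omega>. ((W i \<omega>)\<^sup>2)\<^sup>2)"
      using Wi[OF that, of 4] by (intro square_expectation_le Wi that) simp
    finally have E4: "expectation (W i) ^ 4 \<le> expectation (\<lambda>\<omega>. (W i \<omega>) ^ 4)" by simp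
    have "expectation (\<lambda>\<omega>. (Z i \<omega>) ^ 4)
        \<le> expectation (\<lambda>\<omega>. 8 * ((W i \<omega>) ^ 4 + expectation (W i) ^ 4))"
    proof (intro integral_mono)
      show "integrable M (\<lambda>\<omega>. (Z i \<omega>) ^ 4)"
        by (rule integrable_power_bounded[OF Zm[OF that] Zb[OF that]])
      show "(Z i \<omega>) ^ 4 \<le> 8 * ((W i \<omega>) ^ 4 + expectation (W i) ^ 4)" for \<omega>
        using fourth_power_add_le[of "W i \<omega>" "- expectation (W i)"] by (simp add: Z_def)
    qed (use Wi[OF that] in auto)
    also have "\<dots> = 8 * (expectation (\<lambda>\<omega>. (W i \<omega>) ^ 4) + expectation (W i) ^ 4)"
      using Wi[OF that] by (simp add: prob_space)
    also have "\<dots> \<le> 8 * (N powr (4 - p) * B + N powr (4 - p) * B)"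
      using E4 W4[OF that] by (intro mult_left_mono add_mono order_trans[OF E4]) auto
    finally show ?thesis by (simp add: algebra_simps)
  qed
  define A where "A i = {\<omega> \<in> space M. real N \<le> \<bar>Y i \<omega>\<bar>}" for i
  define D where "D = {\<omega> \<in> space M. \<delta> * N / 2 \<le> \<bar>\<Sum>i\<in>I. Z i \<omega>\<bar>}"
  have Am: "A i \<in> sets M" if "i \<in> I" for i
    unfolding A_def using Ym[OF that] by measurable
  have [measurable]: "(\<lambda>\<omega>. \<Sum>i\<in>I. Z i \<omega>) \<in> borel_measurable M"
    using Zm by auto
  have [measurable]: "D \<in> sets M" unfolding D_def by measurable
  have PA: "prob (A i) \<le> B * N powr - p" if "i \<in> I" for i
  proof -
    have "prob (A i) \<le> prob {\<omega> \<in> space M. N powr p \<le> \<bar>Y i \<omega>\<bar> powr p}"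
      using Ym[OF that] p by (intro finite_measure_mono) (auto simp: A_def intro!: powr_mono2)
    also have "\<dots> \<le> expectation (\<lambda>\<omega>. \<bar>Y i \<omega>\<bar> powr p) / N powr p"
      using N by (intro integral_Markov_inequality_measure[where A = "space M"] pi that) auto
    also have "\<dots> \<le> B / N powr p" by (intro divide_right_mono pB that) auto
    finally show ?thesis by (simp add: powr_minus field_simps)
  qed
  have cardN: "real (card I) \<le> N" using I by simp
  have PD: "prob D \<le> (2 / \<delta>) ^ 4 * (16 * B + 3 * (1 + B)\<^sup>2) * N powr (1 - p)"
  proof -
    let ?S = "\<lambda>\<omega>. \<Sum>i\<in>I. Z i \<omega>"
    have EZ: "expectation (Z i) = 0" if "i \<in> I" for i
      unfolding Z_def using Wi1[OF that] by (simp add: prob_space)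
    have "expectation (\<lambda>\<omega>. ?S \<omega> ^ 4)
        \<le> card I * (16 * (N powr (4 - p) * B)) + 3 * (real (card I))\<^sup>2 * (1 + B)\<^sup>2"
      using fourth_moment_indep_sum[OF I(1) Zind Zb EZ Z2 Z4] by blast
    also have "\<dots> \<le> N * (16 * (N powr (4 - p) * B)) + 3 * (real N)\<^sup>2 * (1 + B)\<^sup>2"
      using cardN B by (intro add_mono mult_right_mono mult_left_mono power_mono) auto
    \<comment> \<open>Here \<open>p \<le> 3\<close> enters: it makes \<open>N^2\<close> at most
      \<open>N powr (5 - p)\<close>, the order of the other term. Division by the fourth power of
      the threshold then leaves \<open>N powr (1 - p)\<close>.\<close>
    also have "\<dots> \<le> (16 * B + 3 * (1 + B)\<^sup>2) * N powr (5 - p)"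
    proof -
      have "N * N powr (4 - p) = N powr (5 - p)"
        using N powr_add[of "real N" 1 "4 - p"] by simp
      moreover have "(real N)\<^sup>2 \<le> N powr (5 - p)"
        using N p powr_mono[of 2 "5 - p" "real N"] by simp
      ultimately have e: "N * N powr (4 - p) = N powr (5 - p)"
        "3 * (real N)\<^sup>2 * (1 + B)\<^sup>2 \<le> 3 * N powr (5 - p) * (1 + B)\<^sup>2"
        by (auto intro!: mult_right_mono)
      have e': "N * (16 * (N powr (4 - p) * B)) = 16 * B * N powr (5 - p)"
        unfolding e(1)[symmetric] by (simp only: ac_simps)
      have "N * (16 * (N powr (4 - p) * B)) + 3 * (real N)\<^sup>2 * (1 + B)\<^sup>2
          \<le> 16 * B * N powr (5 - p) + 3 * N powr (5 - p) * (1 + B)\<^sup>2"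
        by (rule add_mono[OF eq_refl[OF e'] e(2)])
      also have "\<dots> = (16 * B + 3 * (1 + B)\<^sup>2) * N powr (5 - p)" by algebra
      finally show ?thesis .
    qed
    finally have E4: "expectation (\<lambda>\<omega>. ?S \<omega> ^ 4) \<le> (16 * B + 3 * (1 + B)\<^sup>2) * N powr (5 - p)" .
    have Sb: "\<bar>?S \<omega>\<bar> \<le> card I * (2 * N)" for \<omega>
      using sum_norm_bound[of I "\<lambda>j. Z j \<omega>" "2 * N"] Zb by auto
    have D4: "(\<delta> * N / 2) ^ 4 \<le> ?S \<omega> ^ 4" if "\<omega> \<in> D" for \<omega>
      using power_mono[of "\<delta> * N / 2" "\<bar>?S \<omega>\<bar>" 4] that \<delta> by (simp add: D_def power_even_abs)
    have "prob D \<le> prob {\<omega> \<in> space M. (\<delta> * N / 2) ^ 4 \<le> ?S \<omega> ^ 4}"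
      using D4 by (intro finite_measure_mono) (auto simp: D_def)
    also have "\<dots> \<le> expectation (\<lambda>\<omega>. ?S \<omega> ^ 4) / (\<delta> * N / 2) ^ 4"
      using N \<delta> by (intro integral_Markov_inequality_measure[where A = "space M"]
          integrable_power_bounded[OF _ Sb]) auto
    also have "\<dots> \<le> (16 * B + 3 * (1 + B)\<^sup>2) * N powr (5 - p) / (\<delta> * N / 2) ^ 4"
      by (intro divide_right_mono E4) simp
    also have "\<dots> = (2 / \<delta>) ^ 4 * (16 * B + 3 * (1 + B)\<^sup>2) * (N powr (5 - p) / N powr 4)"
      using N \<delta> by (simp add: field_simps)
    also have "N powr (5 - p) / N powr 4 = N powr (1 - p)"
      unfolding powr_diff[symmetric] by simp
    finally show ?thesis .
  qed
  \<comment> \<open>Outside all \<open>A i\<close> no summand has been changed, so the sum of the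
    \<open>Y i\<close> is the recentred sum plus the total bias. Each of the two receives half of
    the threshold.\<close>
  have incl: "{\<omega> \<in> space M. \<delta> * N < \<bar>\<Sum>i\<in>I. Y i \<omega>\<bar>} \<subseteq> (\<Union>i\<in>I. A i) \<union> D"
  proof (intro subsetI, rule ccontr)
    fix \<omega> assume *: "\<omega> \<in> {\<omega> \<in> space M. \<delta> * N < \<bar>\<Sum>i\<in>I. Y i \<omega>\<bar>}" "\<omega> \<notin> (\<Union>i\<in>I. A i) \<union> D"
    then have sm: "\<bar>\<Sum>i\<in>I. Z i \<omega>\<bar> < \<delta> * N / 2" and "Y i \<omega> = W i \<omega>" if "i \<in> I" for i
      using that by (auto simp: A_def D_def W_def tr_def not_le)
    then have "(\<Sum>i\<in>I. Y i \<omega>) = (\<Sum>i\<in>I. Z i \<omega> + expectation (W i))"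
      by (intro sum.cong) (auto simp: Z_def)
    then have eq: "(\<Sum>i\<in>I. Y i \<omega>) = (\<Sum>i\<in>I. Z i \<omega>) + (\<Sum>i\<in>I. expectation (W i))"
      by (simp add: sum.distrib)
    have sm: "\<bar>\<Sum>i\<in>I. Z i \<omega>\<bar> < \<delta> * N / 2" using * by (auto simp: D_def not_le)
    have "\<bar>\<Sum>i\<in>I. expectation (W i)\<bar> \<le> card I * ((1 + B) / N)"
      using sum_norm_bound[of I "\<lambda>i. expectation (W i)" "(1 + B) / N"] EW by auto
    also have "\<dots> \<le> N * ((1 + B) / N)"
      using cardN B by (intro mult_right_mono) auto
    also have "\<dots> \<le> \<delta> * N / 2" using N by simp
    finally show False using eq sm * by auto
  qed
  have "prob {\<omega> \<in> space M. \<delta> * N < \<bar>\<Sum>i\<in>I. Y i \<omega>\<bar>} \<le> prob ((\<Union>i\<in>I. A i) \<union> D)"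
    using I Am by (intro finite_measure_mono incl sets.Un sets.finite_UN) auto
  also have "\<dots> \<le> prob (\<Union>i\<in>I. A i) + prob D"
    using I Am by (intro measure_Un_le sets.finite_UN) auto
  also have "prob (\<Union>i\<in>I. A i) \<le> (\<Sum>i\<in>I. prob (A i))"
    using I Am by (intro finite_measure_subadditive_finite) auto
  also have "\<dots> \<le> card I * (B * N powr - p)"
    using sum_bounded_above[of I "\<lambda>i. prob (A i)" "B * N powr - p"] PA by simp
  also have "\<dots> \<le> N * (B * N powr - p)"
    using cardN B by (intro mult_right_mono) auto
  also have "\<dots> = B * N powr (1 - p)"
    using N by (simp add: powr_diff powr_minus field_simps)
  finally show ?thesis using PD by (simp add: algebra_simps)
qed

section \<open>Blocks of a configuration under the product law\<close>

text \<open>The window \<open>i + 1, ..., i + k\<close> is moved to \<open>1, ..., k\<close> and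
  filled up with 0, the default value of \<open>config_law\<close>, so that the image of a
  configuration law can equal a configuration law of length \<open>k\<close> exactly.\<close>

definition block :: "nat \<Rightarrow> nat \<Rightarrow> (nat \<Rightarrow> nat) \<Rightarrow> nat \<Rightarrow> nat" where
  "block k i e = (\<lambda>j. if j \<in> {1..k} then e (i + j) else 0)"

lemma tau_eq_block:
  assumes "local_function k g"
  shows "tau i g e = g (block k i e)"
  unfolding tau_def block_def by (rule assms[unfolded local_function_def, rule_format]) simp

text \<open>The preimage of a configuration under \<open>block k i\<close> is a cylinder, with one
  value prescribed at each site of the window and no restriction elsewhere. Its product measure
  factorizes, and the unrestricted sites contribute 1.\<close>

lemma map_block_config_law:
  assumes "i + k \<le> N"
  shows "map_pmf (block k i) (config_law N \<theta>) = config_law k (\<lambda>j. \<theta> (i + j))"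
proof (rule pmf_eqI)
  fix x :: "nat \<Rightarrow> nat"
  show "pmf (map_pmf (block k i) (config_law N \<theta>)) x = pmf (config_law k (\<lambda>j. \<theta> (i + j))) x"
  proof (cases "\<forall>j. j \<notin> {1..k} \<longrightarrow> x j = 0")
    case True
    define C where "C m = (if m \<in> {i + 1..i + k} then {x (m - i)} else UNIV)" for m
    have "e \<in> Pi {1..N} C \<longleftrightarrow> block k i e = x" for e
    proof
      assume e: "e \<in> Pi {1..N} C"
      have "block k i e j = x j" for j
      proof (cases "j \<in> {1..k}")
        case j: True
        then have "e (i + j) \<in> C (i + j)" using assms e by (auto simp: Pi_iff)
        then show ?thesis using j by (simp add: C_def block_def)
      qed (use True in \<open>auto simp: block_def\<close>)
      then show "block k i e = x" by blast
    next
      assume x: "block k i e = x"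
      have "x (m - i) = e m" if "m \<in> {i + 1..i + k}" for m
        using that unfolding x[symmetric] by (auto simp: block_def)
      then show "e \<in> Pi {1..N} C" by (auto simp: C_def)
    qed
    then have "block k i -` {x} = Pi {1..N} C" by auto
    then have "pmf (map_pmf (block k i) (config_law N \<theta>)) x
        = (\<Prod>m\<in>{1..N}. measure_pmf.prob (nu (\<theta> m)) (C m))"
      by (simp add: pmf_map config_law_def measure_Pi_pmf_Pi)
    also have "\<dots> = (\<Prod>m\<in>{1 + i..k + i}. measure_pmf.prob (nu (\<theta> m)) (C m))"
      using assms by (intro prod.mono_neutral_right) (auto simp: C_def)
    also have "\<dots> = (\<Prod>j\<in>{1..k}. pmf (nu (\<theta> (i + j))) (x j))"
      by (subst prod.shift_bounds_cl_nat_ivl) (auto simp: C_def measure_pmf_single add.commute intro!: prod.cong)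
    also have "\<dots> = pmf (config_law k (\<lambda>j. \<theta> (i + j))) x"
      unfolding config_law_def using True by (subst pmf_Pi') auto
    finally show ?thesis .
  next
    case False
    then have "x \<notin> range (block k i)" by (auto simp: block_def)
    then have "pmf (map_pmf (block k i) (config_law N \<theta>)) x = 0"
      by (auto simp: pmf_eq_0_set_pmf)
    moreover have "pmf (config_law k (\<lambda>j. \<theta> (i + j))) x = 0"
      unfolding config_law_def using False by (intro pmf_Pi_outside) auto
    ultimately show ?thesis by simp
  qed
qed

lemma cexp_tau:
  assumes "local_function k g" "i + k \<le> N"
  shows "cexp N \<theta> (tau i g) = cexp k (\<lambda>j. \<theta> (i + j)) g"
  unfolding cexp_def map_block_config_law[OF assms(2), where \<theta> = \<theta>, symmetric]
  by (simp add: tau_eq_block[OF assms(1), abs_def])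

text \<open>Indices at distance at least \<open>k\<close> have disjoint windows, and functions of
  disjoint groups of independent coordinates are independent.\<close>

lemma indep_vars_tau:
  assumes "local_function k g" and L: "\<And>i. i \<in> L \<Longrightarrow> i + k \<le> N"
    and sep: "\<And>i j. i \<in> L \<Longrightarrow> j \<in> L \<Longrightarrow> i < j \<Longrightarrow> i + k \<le> j"
  shows "prob_space.indep_vars (measure_pmf (config_law N \<theta>)) (\<lambda>_. borel) (\<lambda>i. tau i g) L"
proof -
  let ?indep = "prob_space.indep_vars (measure_pmf (config_law N \<theta>))"
  have 1: "?indep (\<lambda>_. count_space UNIV) (\<lambda>m e. e m) {1..N}"
    unfolding config_law_def by (rule indep_vars_Pi_pmf) simp
  have dis: "disjoint_family_on (\<lambda>i. {i + 1..i + k}) L"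
    unfolding disjoint_family_on_def
  proof (intro ballI impI)
    fix i j assume "i \<in> L" "j \<in> L" "i \<noteq> j"
    then show "{i + 1..i + k} \<inter> {j + 1..j + k} = {}"
      using sep[of i j] sep[of j i] by (cases "i < j") auto
  qed
  have 2: "?indep (\<lambda>i. PiM {i + 1..i + k} (\<lambda>_. count_space UNIV))
      (\<lambda>i e. restrict (\<lambda>m. e m) {i + 1..i + k}) L"
    using L by (intro prob_space.indep_vars_restrict[OF measure_pmf.prob_space_axioms 1 _ dis]) fastforce
  have 3: "?indep (\<lambda>_. borel)
      (\<lambda>i e. g (\<lambda>j. restrict (\<lambda>m. e m) {i + 1..i + k} (i + j))) L"
    by (rule prob_space.indep_vars_compose2[OF measure_pmf.prob_space_axioms 2]) (simp add: count_space_PiM_finite)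
  \<comment> \<open>Outside the window \<open>restrict\<close> returns an arbitrary value, which a
    local function does not see.\<close>
  have "g (\<lambda>j. restrict (\<lambda>m. e m) {i + 1..i + k} (i + j)) = tau i g e" for i e
    unfolding tau_def by (rule assms(1)[unfolded local_function_def, rule_format]) simp
  then show ?thesis using 3 by simp
qed

text \<open>These are the parameter vectors for which the hypotheses on \<open>g\<close> are
  available. Constant vectors and windows of admissible vectors stay in the class, which is what
  makes comparison with \<open>h_fun\<close> possible.\<close>

definition admissible :: "real \<Rightarrow> real \<Rightarrow> nat \<Rightarrow> (nat \<Rightarrow> real) \<Rightarrow> bool" where
  "admissible a b N \<theta> \<longleftrightarrow> (\<forall>j\<in>{1..N}. a \<le> \<theta> j \<and> \<theta> j < b) \<and> mono_on {1..N} \<theta>"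

lemma admissible_shift:
  assumes "admissible a b N \<theta>" "i + k \<le> N"
  shows "admissible a b k (\<lambda>j. \<theta> (i + j))"
proof -
  have *: "i + j \<in> {1..N}" if "j \<in> {1..k}" for j using that assms(2) by auto
  have "mono_on {1..k} (\<lambda>j. \<theta> (i + j))"
    using assms(1) * unfolding admissible_def mono_on_def by simp
  then show ?thesis using assms(1) * unfolding admissible_def by blast
qed

lemma admissible_const: "a \<le> r \<Longrightarrow> r < b \<Longrightarrow> admissible a b N (\<lambda>_. r)"
  by (simp add: admissible_def mono_on_def)

lemma admissible_nonneg: "0 \<le> a \<Longrightarrow> admissible a b N \<theta> \<Longrightarrow> j \<in> {1..N} \<Longrightarrow> 0 \<le> \<theta> j"
  unfolding admissible_def using order_trans by blast

text \<open>The moment conditions are kept for vectors of length \<open>k\<close>, since windows of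
  longer admissible vectors reduce to these. The range of \<open>p\<close> is the one in which the
  truncation estimate applies and its bound is summable.\<close>

locale local_observable =
  fixes a b p B :: real and k :: nat and g :: "(nat \<Rightarrow> nat) \<Rightarrow> real"
  assumes a: "0 \<le> a" and ab: "a < b" and k: "1 \<le> k" and local: "local_function k g"
    and p: "2 < p" "p \<le> 3"
    and central: "admissible a b k \<theta> \<Longrightarrow> integrable (config_law k \<theta>) (\<lambda>e. \<bar>g e - cexp k \<theta> g\<bar> powr p)"
    and central_le: "admissible a b k \<theta> \<Longrightarrow> cexp k \<theta> (\<lambda>e. \<bar>g e - cexp k \<theta> g\<bar> powr p) \<le> B"
    and int: "admissible a b k \<theta> \<Longrightarrow> integrable (config_law k \<theta>) g"
begin

lemma B_nonneg: "0 \<le> B"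
proof -
  have "0 \<le> cexp k (\<lambda>_. a) (\<lambda>e. \<bar>g e - cexp k (\<lambda>_. a) g\<bar> powr p)"
    unfolding cexp_def by (intro Bochner_Integration.integral_nonneg) auto
  also have "\<dots> \<le> B" using ab by (intro central_le admissible_const) auto
  finally show ?thesis .
qed

lemma integrable_tau:
  assumes \<theta>: "admissible a b N \<theta>" and iN: "i + k \<le> N"
  shows "integrable (config_law N \<theta>) (tau i g)"
  using int[OF admissible_shift[OF \<theta> iN]]
  unfolding map_block_config_law[OF iN, where \<theta> = \<theta>, symmetric]
  by (simp add: tau_eq_block[OF local, abs_def])

text \<open>Each of the \<open>k\<close> residue classes is allotted the threshold
  \<open>\<delta> / k * N\<close>, and the union bound over the classes produces the leading factor
  \<open>k\<close>. The weights \<open>c i\<close> enter the \<open>p\<close>-th moments through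
  \<open>\<Phi> powr p\<close>.\<close>

lemma conditional_deviation:
  assumes \<theta>: "admissible a b N \<theta>" and kN: "k \<le> N" and \<Phi>: "\<And>i. i \<le> N - k \<Longrightarrow> \<bar>c i\<bar> \<le> \<Phi>"
    and \<delta>: "0 < \<delta>" and N: "2 * (1 + \<Phi> powr p * B) \<le> \<delta> / k * N"
  shows "measure_pmf.prob (config_law N \<theta>)
      {e. \<delta> * N < \<bar>\<Sum>i=0..N - k. c i * (tau i g e - cexp N \<theta> (tau i g))\<bar>}
    \<le> k * (\<Phi> powr p * B + (2 / (\<delta> / k)) ^ 4 * (16 * (\<Phi> powr p * B) + 3 * (1 + \<Phi> powr p * B)\<^sup>2))
      * N powr (1 - p)"
proof -
  let ?Q = "measure_pmf (config_law N \<theta>)"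
  let ?prob = "measure ?Q" and ?E = "integral\<^sup>L ?Q" and ?indep = "prob_space.indep_vars ?Q"
  define Y where "Y i e = c i * (tau i g e - cexp N \<theta> (tau i g))" for i e
  define C where "C = \<Phi> powr p * B + (2 / (\<delta> / k)) ^ 4 * (16 * (\<Phi> powr p * B) + 3 * (1 + \<Phi> powr p * B)\<^sup>2)"
  define L where "L r = {i \<in> {0..N - k}. i mod k = r}" for r
  have iN: "i + k \<le> N" if "i \<le> N - k" for i using that kN by simp
  note law = map_block_config_law[OF iN, where \<theta> = \<theta>, symmetric]
  have tau_int: "integrable ?Q (tau i g)" if "i \<le> N - k" for i
    by (rule integrable_tau[OF \<theta> iN[OF that]])
  have central': "integrable ?Q (\<lambda>e. \<bar>tau i g e - cexp N \<theta> (tau i g)\<bar> powr p)"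
    "?E (\<lambda>e. \<bar>tau i g e - cexp N \<theta> (tau i g)\<bar> powr p) \<le> B" if "i \<le> N - k" for i
    using central[OF admissible_shift[OF \<theta> iN[OF that]]] central_le[OF admissible_shift[OF \<theta> iN[OF that]]]
    unfolding cexp_tau[OF local iN[OF that]] cexp_def law[OF that]
    by (simp_all add: tau_eq_block[OF local, abs_def])
  have Yi: "integrable ?Q (Y i)" if "i \<le> N - k" for i
    unfolding Y_def using tau_int[OF that] by simp
  have Ymean: "?E (Y i) = 0" if "i \<le> N - k" for i
    unfolding Y_def using tau_int[OF that] by (simp add: cexp_def)
  have Yp: "\<bar>Y i e\<bar> powr p = \<bar>c i\<bar> powr p * \<bar>tau i g e - cexp N \<theta> (tau i g)\<bar> powr p" for i e
    by (simp add: Y_def abs_mult powr_mult)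
  have Ypi: "integrable ?Q (\<lambda>e. \<bar>Y i e\<bar> powr p)" if "i \<le> N - k" for i
    unfolding Yp using central'[OF that] by simp
  have YpB: "?E (\<lambda>e. \<bar>Y i e\<bar> powr p) \<le> \<Phi> powr p * B" if "i \<le> N - k" for i
    unfolding Yp using central'[OF that] \<Phi>[OF that] p
    by (auto intro!: mult_mono powr_mono2 Bochner_Integration.integral_nonneg)
  have dev: "?prob {e. \<delta> / k * N < \<bar>\<Sum>i\<in>L r. Y i e\<bar>} \<le> C * N powr (1 - p)" for r
  proof -
    have ind: "?indep (\<lambda>_. borel) Y (L r)"
    proof -
      have "?indep (\<lambda>_. borel) (\<lambda>i. tau i g) (L r)"
      proof (rule indep_vars_tau[OF local])
        fix i j assume "i \<in> L r" "j \<in> L r" "i < j"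
        then have "k dvd j - i" by (simp add: L_def mod_eq_dvd_iff_nat[symmetric])
        then have "k \<le> j - i" using \<open>i < j\<close> by (intro dvd_imp_le) auto
        then show "i + k \<le> j" using \<open>i < j\<close> by simp
      qed (use kN in \<open>auto simp: L_def\<close>)
      then show ?thesis unfolding Y_def by (rule prob_space.indep_vars_compose2[OF measure_pmf.prob_space_axioms]) measurable
    qed
    have "card (L r) \<le> card {0..N - k}" unfolding L_def by (intro card_mono) auto
    also have "\<dots> \<le> N" using k kN by simp
    finally show ?thesis
      using prob_space.indep_sum_deviation[OF measure_pmf.prob_space_axioms, of "L r" N "config_law N \<theta>" Y p "\<Phi> powr p * B" "\<delta> / k"]
        ind Yi Ymean Ypi YpB p B_nonneg \<delta> k kN N
      by (simp add: C_def L_def)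
  qed
  have split: "(\<Sum>i=0..N - k. Y i e) = (\<Sum>r<k. \<Sum>i\<in>L r. Y i e)" for e
    unfolding L_def using k by (intro sum.group[symmetric]) auto
  have incl: "{e. \<delta> * N < \<bar>\<Sum>i=0..N - k. Y i e\<bar>} \<subseteq> (\<Union>r\<in>{..<k}. {e. \<delta> / k * N < \<bar>\<Sum>i\<in>L r. Y i e\<bar>})"
  proof (intro subsetI, rule ccontr)
    fix e assume *: "e \<in> {e. \<delta> * N < \<bar>\<Sum>i=0..N - k. Y i e\<bar>}"
      "e \<notin> (\<Union>r\<in>{..<k}. {e. \<delta> / k * N < \<bar>\<Sum>i\<in>L r. Y i e\<bar>})"
    then have "\<bar>\<Sum>r<k. \<Sum>i\<in>L r. Y i e\<bar> \<le> k * (\<delta> / k * N)"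
      using sum_norm_bound[of "{..<k}" "\<lambda>r. \<Sum>i\<in>L r. Y i e" "\<delta> / k * N"] by (auto simp: not_less)
    then show False using * k by (simp add: split)
  qed
  have "?prob {e. \<delta> * N < \<bar>\<Sum>i=0..N - k. Y i e\<bar>}
      \<le> ?prob (\<Union>r\<in>{..<k}. {e. \<delta> / k * N < \<bar>\<Sum>i\<in>L r. Y i e\<bar>})"
    by (intro measure_pmf.finite_measure_mono incl) auto
  also have "\<dots> \<le> (\<Sum>r<k. ?prob {e. \<delta> / k * N < \<bar>\<Sum>i\<in>L r. Y i e\<bar>})"
    by (intro measure_pmf.finite_measure_subadditive_finite) auto
  also have "\<dots> \<le> (\<Sum>r<k. C * N powr (1 - p))" by (intro sum_mono dev)
  finally show ?thesis by (simp add: Y_def C_def mult.assoc)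
qed

end

section \<open>The mean of a local function as a function of the parameters\<close>

text \<open>The ratio \<open>\<theta> / (1 + \<theta>)\<close> increases with
  \<open>\<theta>\<close>, so only the prefactors need compensation, and
  \<open>(1 + t) / (1 + s)\<close> is at most \<open>1 + (t - s)\<close>. The factor tends to 1 as
  \<open>t - s\<close> tends to 0, uniformly in \<open>n\<close>.\<close>

lemma pmf_nu_le:
  assumes "0 \<le> s" "s \<le> t"
  shows "pmf (nu s) n \<le> (1 + (t - s)) * pmf (nu t) n"
proof -
  have "0 \<le> s * (t - s)" using assms by simp
  then have "1 + t \<le> (1 + s) * (1 + (t - s))" by (simp add: algebra_simps)
  then have 1: "1 / (1 + s) \<le> (1 + (t - s)) * (1 / (1 + t))"
    using assms by (simp add: field_simps)
  have "s / (1 + s) \<le> t / (1 + t)" using assms by (simp add: field_simps)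
  then have "1 / (1 + s) * (s / (1 + s)) ^ n \<le> (1 + (t - s)) * (1 / (1 + t)) * (t / (1 + t)) ^ n"
    using assms by (intro mult_mono 1 power_mono) auto
  then show ?thesis using assms by (simp add: pmf_nu)
qed

lemma pmf_config_law_le:
  assumes "\<And>j. j \<in> {1..k} \<Longrightarrow> 0 \<le> \<theta> j" "\<And>j. j \<in> {1..k} \<Longrightarrow> \<theta> j \<le> s j"
  shows "pmf (config_law k \<theta>) e \<le> (\<Prod>j\<in>{1..k}. 1 + (s j - \<theta> j)) * pmf (config_law k s) e"
proof (cases "\<forall>j. j \<notin> {1..k} \<longrightarrow> e j = 0")
  case True
  have "(\<Prod>j\<in>{1..k}. pmf (nu (\<theta> j)) (e j)) \<le> (\<Prod>j\<in>{1..k}. (1 + (s j - \<theta> j)) * pmf (nu (s j)) (e j))"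
    using assms by (intro prod_mono conjI pmf_nu_le) auto
  then show ?thesis
    unfolding config_law_def using True by (subst (1 2) pmf_Pi') (auto simp: prod.distrib)
next
  case False
  then show ?thesis unfolding config_law_def by (subst (1 2) pmf_Pi_outside) auto
qed

lemma expectation_le_of_pmf_le:
  fixes f :: "'x \<Rightarrow> real"
  assumes le: "\<And>x. pmf P x \<le> c * pmf Q x" and f: "\<And>x. 0 \<le> f x"
    and Q: "integrable (measure_pmf Q) f" and c: "0 \<le> c"
  shows "measure_pmf.expectation P f \<le> c * measure_pmf.expectation Q f"
proof -
  have "(\<integral>\<^sup>+x. f x \<partial>P) = (\<integral>\<^sup>+x. ennreal (pmf P x) * f x \<partial>count_space UNIV)"
    by (rule nn_integral_measure_pmf)
  also have "\<dots> \<le> (\<integral>\<^sup>+x. ennreal c * (ennreal (pmf Q x) * f x) \<partial>count_space UNIV)"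
    using le f c by (intro nn_integral_mono)
      (auto simp: ennreal_mult[symmetric] mult.assoc[symmetric] intro!: ennreal_leI mult_right_mono)
  also have "\<dots> = ennreal c * (\<integral>\<^sup>+x. f x \<partial>Q)"
    by (simp add: nn_integral_cmult nn_integral_measure_pmf)
  also have "\<dots> = ennreal (c * measure_pmf.expectation Q f)"
    using Q f c by (simp add: nn_integral_eq_integral ennreal_mult Bochner_Integration.integral_nonneg)
  finally have "(\<integral>\<^sup>+x. f x \<partial>P) \<le> ennreal (c * measure_pmf.expectation Q f)" .
  then show ?thesis
    using f c by (intro integral_real_bounded) (auto intro!: mult_nonneg_nonneg Bochner_Integration.integral_nonneg)
qed

text \<open>The functions \<open>L + g\<^sup>2 / L \<plusminus> g\<close> are nonnegative, so a domination of densities transfers to them.\<close>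

lemma expectation_diff_le_of_pmf_le:
  fixes g :: "'x \<Rightarrow> real"
  assumes le: "\<And>x. pmf P x \<le> c * pmf Q x" and c: "1 \<le> c" and L: "0 < L"
    and P: "integrable (measure_pmf P) g" "integrable (measure_pmf P) (\<lambda>x. (g x)\<^sup>2)"
    and Q: "integrable (measure_pmf Q) g" "integrable (measure_pmf Q) (\<lambda>x. (g x)\<^sup>2)"
    and K: "\<bar>measure_pmf.expectation Q g\<bar> \<le> K" and V: "measure_pmf.expectation Q (\<lambda>x. (g x)\<^sup>2) \<le> V"
  shows "\<bar>measure_pmf.expectation P g - measure_pmf.expectation Q g\<bar> \<le> (c - 1) * (L + K) + c * V / L"
proof -
  let ?P = "measure_pmf.expectation P" and ?Q = "measure_pmf.expectation Q"
  have key: "\<sigma> * (?P g - ?Q g) \<le> (c - 1) * (L + K) + c * V / L" if "\<sigma> = 1 \<or> \<sigma> = - 1" for \<sigma> :: real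
  proof -
    have sq: "0 \<le> L + (g x)\<^sup>2 / L + \<sigma> * g x" for x
    proof -
      have "0 \<le> (L + \<sigma> * g x)\<^sup>2 + L\<^sup>2 + (g x)\<^sup>2" by simp
      also have "\<dots> = 2 * L * (L + (g x)\<^sup>2 / L + \<sigma> * g x)"
        using L that by (auto simp: power2_eq_square field_simps)
      finally show ?thesis using L by (simp add: zero_le_mult_iff)
    qed
    have "?P (\<lambda>x. L + (g x)\<^sup>2 / L + \<sigma> * g x) \<le> c * ?Q (\<lambda>x. L + (g x)\<^sup>2 / L + \<sigma> * g x)"
      using c Q by (intro expectation_le_of_pmf_le le sq) auto
    then have *: "L + ?P (\<lambda>x. (g x)\<^sup>2) / L + \<sigma> * ?P g \<le> c * (L + ?Q (\<lambda>x. (g x)\<^sup>2) / L + \<sigma> * ?Q g)"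
      using P Q by (simp add: measure_pmf.prob_space)
    \<comment> \<open>The second moment under \<open>P\<close> is dropped from the left of
      \<open>*\<close>. On the right, splitting \<open>c\<close> as \<open>1 + (c - 1)\<close>
      isolates the mean under \<open>Q\<close>; the term \<open>(c - 1) * L\<close> is the price of
      the constant added for positivity.\<close>
    have "0 \<le> ?P (\<lambda>x. (g x)\<^sup>2) / L" using L by (simp add: Bochner_Integration.integral_nonneg)
    moreover have "c * (?Q (\<lambda>x. (g x)\<^sup>2) / L) \<le> c * (V / L)"
      using c L V by (intro mult_left_mono divide_right_mono) auto
    moreover have "(c - 1) * (\<sigma> * ?Q g) \<le> (c - 1) * K"
      using c K that by (intro mult_left_mono) auto
    ultimately show ?thesis using * by (simp add: algebra_simps)
  qed
  show ?thesis using key[of 1] key[of "- 1"] by (simp add: abs_le_iff)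
qed

context local_observable
begin

text \<open>
  The configuration \<open>0\<close> is charged uniformly in the parameters, so the bound on the central moment
  keeps the mean of \<open>g\<close> close to \<open>g 0\<close>.
\<close>

lemma mean_bounded:
  assumes "admissible a b k \<theta>"
  shows "\<bar>cexp k \<theta> g\<bar> \<le> \<bar>g (\<lambda>_. 0)\<bar> + (2 + (1 + b) ^ k * B)"
proof -
  let ?m = "cexp k \<theta> g" and ?z = "\<lambda>_::nat. 0::nat"
  have \<theta>: "0 \<le> \<theta> j" "\<theta> j \<le> b" if "j \<in> {1..k}" for j
    using admissible_nonneg[OF a assms that] assms that by (auto simp: admissible_def less_imp_le)
  \<comment> \<open>A geometric law of mean at most \<open>b\<close> gives 0 mass at least
    \<open>1 / (1 + b)\<close>; the inverse of the product over \<open>k\<close> sites is the factor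
    \<open>(1 + b) ^ k\<close> of the bound.\<close>
  have "(1 / (1 + b)) ^ k = (\<Prod>j\<in>{1..k}. 1 / (1 + b))" by simp
  also have "\<dots> \<le> (\<Prod>j\<in>{1..k}. pmf (nu (\<theta> j)) (?z j))"
    using \<theta> a ab by (intro prod_mono) (auto simp: pmf_nu intro!: divide_left_mono mult_pos_pos add_pos_nonneg)
  also have "\<dots> = pmf (config_law k \<theta>) ?z"
    unfolding config_law_def by (subst pmf_Pi') auto
  finally have c: "(1 / (1 + b)) ^ k \<le> pmf (config_law k \<theta>) ?z" .
  have "(1 / (1 + b)) ^ k * \<bar>g ?z - ?m\<bar> powr p \<le> pmf (config_law k \<theta>) ?z * \<bar>g ?z - ?m\<bar> powr p"
    by (intro mult_right_mono c) auto
  also have "\<dots> = measure_pmf.expectation (config_law k \<theta>) (\<lambda>e. indicat_real {?z} e * \<bar>g ?z - ?m\<bar> powr p)"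
    by (simp add: measure_pmf_single)
  also have "\<dots> \<le> cexp k \<theta> (\<lambda>e. \<bar>g e - ?m\<bar> powr p)"
    unfolding cexp_def
  proof (rule integral_mono)
    show "integrable (config_law k \<theta>) (\<lambda>e. indicat_real {?z} e * \<bar>g ?z - integral\<^sup>L (config_law k \<theta>) g\<bar> powr p)"
      by (intro integrable_mult_left integrable_real_indicator) (auto simp: measure_pmf.emeasure_eq_measure)
    show "integrable (config_law k \<theta>) (\<lambda>e. \<bar>g e - integral\<^sup>L (config_law k \<theta>) g\<bar> powr p)"
      using central[OF assms] by (simp add: cexp_def)
  qed (auto simp: indicator_def)
  also have "\<dots> \<le> B" by (rule central_le[OF assms])
  finally have "\<bar>g ?z - ?m\<bar> powr p \<le> (1 + b) ^ k * B"
    using a ab by (simp add: field_simps)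
  moreover have "(g ?z - ?m)\<^sup>2 \<le> 1 + \<bar>g ?z - ?m\<bar> powr p"
    using p by (intro square_le_one_plus_powr) auto
  \<comment> \<open>This inequality and the preceding one each contribute 1 to the constant 2 of the
    bound.\<close>
  moreover have "\<bar>g ?z - ?m\<bar> \<le> 1 + (g ?z - ?m)\<^sup>2"
  proof -
    have "\<bar>g ?z - ?m\<bar> \<le> 2 * \<bar>g ?z - ?m\<bar>" by simp
    also have "\<dots> \<le> 1 + (g ?z - ?m)\<^sup>2" using sum_squares_bound[of "\<bar>g ?z - ?m\<bar>" 1] by simp
    finally show ?thesis .
  qed
  ultimately show ?thesis by linarith
qed

text \<open>Supplies the uniform constant \<open>V\<close> for the comparison of means, by splitting
  \<open>g\<close> into its mean and its fluctuation.\<close>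

lemma second_moment_bounded:
  assumes "admissible a b k \<theta>"
  shows "integrable (config_law k \<theta>) (\<lambda>e. (g e)\<^sup>2)"
    and "cexp k \<theta> (\<lambda>e. (g e)\<^sup>2) \<le> 2 * (1 + B) + 2 * (\<bar>g (\<lambda>_. 0)\<bar> + (2 + (1 + b) ^ k * B))\<^sup>2"
proof -
  let ?m = "cexp k \<theta> g"
  have le: "(g e)\<^sup>2 \<le> 2 * (1 + \<bar>g e - ?m\<bar> powr p) + 2 * ?m\<^sup>2" for e
  proof -
    have "(g e)\<^sup>2 \<le> 2 * (g e - ?m)\<^sup>2 + 2 * ?m\<^sup>2"
      using zero_le_power2[of "g e - 2 * ?m"] by (simp add: power2_eq_square algebra_simps)
    then show ?thesis using square_le_one_plus_powr[of p "g e - ?m"] p by simp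
  qed
  have I: "integrable (config_law k \<theta>) (\<lambda>e. 2 * (1 + \<bar>g e - ?m\<bar> powr p) + 2 * ?m\<^sup>2)"
    using central[OF assms] by simp
  show 1: "integrable (config_law k \<theta>) (\<lambda>e. (g e)\<^sup>2)"
    by (rule Bochner_Integration.integrable_bound[OF I]) (auto intro!: order_trans[OF le])
  have "cexp k \<theta> (\<lambda>e. (g e)\<^sup>2) \<le> cexp k \<theta> (\<lambda>e. 2 * (1 + \<bar>g e - ?m\<bar> powr p) + 2 * ?m\<^sup>2)"
    using 1 I le unfolding cexp_def by (intro integral_mono) auto
  also have "\<dots> = 2 * (1 + cexp k \<theta> (\<lambda>e. \<bar>g e - ?m\<bar> powr p)) + 2 * ?m\<^sup>2"
    using central[OF assms] by (simp add: cexp_def measure_pmf.prob_space)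
  also have "\<dots> \<le> 2 * (1 + B) + 2 * (\<bar>g (\<lambda>_. 0)\<bar> + (2 + (1 + b) ^ k * B))\<^sup>2"
    using power_mono[OF mean_bounded[OF assms], of 2] central_le[OF assms]
    by (intro add_mono mult_left_mono) auto
  finally show "cexp k \<theta> (\<lambda>e. (g e)\<^sup>2) \<le> 2 * (1 + B) + 2 * (\<bar>g (\<lambda>_. 0)\<bar> + (2 + (1 + b) ^ k * B))\<^sup>2" .
qed

text \<open>Neither \<open>v n\<close> nor the constant vector \<open>r\<close> need dominate the
  other, so both are compared with a constant vector lying above them. For fixed \<open>L\<close>
  the density factors tend to 1 and the error tends to \<open>2 * V / L\<close>; only then is
  \<open>L\<close> taken large.\<close>

lemma cexp_tendsto_h:
  assumes v: "\<And>n. admissible a b k (v n)" and r: "a \<le> r" "r < b"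
    and lim: "\<And>j. j \<in> {1..k} \<Longrightarrow> (\<lambda>n. v n j) \<longlonglongrightarrow> r"
  shows "(\<lambda>n. cexp k (v n) g) \<longlonglongrightarrow> h_fun k g r"
proof -
  define K where "K = \<bar>g (\<lambda>_. 0)\<bar> + (2 + (1 + b) ^ k * B)"
  define V where "V = 2 * (1 + B) + 2 * (\<bar>g (\<lambda>_. 0)\<bar> + (2 + (1 + b) ^ k * B))\<^sup>2"
  have V: "0 \<le> V" using B_nonneg by (simp add: V_def)
  have diff: "\<bar>cexp k \<theta> g - cexp k (\<lambda>_. s) g\<bar> \<le> ((\<Prod>j\<in>{1..k}. 1 + (s - \<theta> j)) - 1) * (L + K)
      + (\<Prod>j\<in>{1..k}. 1 + (s - \<theta> j)) * V / L"
    if \<theta>: "admissible a b k \<theta>" and s: "a \<le> s" "s < b" and le: "\<And>j. j \<in> {1..k} \<Longrightarrow> \<theta> j \<le> s" and "0 < L"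
    for \<theta> s L
  proof -
    have adm: "admissible a b k (\<lambda>_. s)" by (rule admissible_const[OF s])
    have "\<bar>measure_pmf.expectation (config_law k (\<lambda>_. s)) g\<bar> \<le> K"
      "measure_pmf.expectation (config_law k (\<lambda>_. s)) (\<lambda>e. (g e)\<^sup>2) \<le> V"
      using mean_bounded[OF adm] second_moment_bounded(2)[OF adm] by (auto simp: K_def V_def cexp_def)
    moreover have "0 \<le> \<theta> j" if "j \<in> {1..k}" for j
      using \<theta> that by (rule admissible_nonneg[OF a])
    ultimately show ?thesis
      unfolding cexp_def using \<open>0 < L\<close> le
      by (intro expectation_diff_le_of_pmf_le pmf_config_law_le int second_moment_bounded(1) adm \<theta> prod_ge_1)
        auto
  qed
  \<comment> \<open>As \<open>v n\<close> is non-decreasing, its last entry bounds all the others;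
    hence \<open>s n\<close> lies above both vectors, stays below \<open>b\<close> and tends to
    \<open>r\<close>.\<close>
  define s where "s n = max r (v n k)" for n
  have kk: "k \<in> {1..k}" using k by simp
  have s: "a \<le> s n" "s n < b" "r \<le> s n" for n
    using r v[of n] kk by (auto simp: s_def admissible_def)
  have vs: "v n j \<le> s n" if "j \<in> {1..k}" for n j
    using v[of n] that kk unfolding s_def admissible_def mono_on_def by (auto simp: le_max_iff_disj)
  have slim: "s \<longlonglongrightarrow> r"
    using tendsto_max[OF tendsto_const lim[OF kk], of r] by (simp add: s_def[abs_def])
  define u where "u n L = ((\<Prod>j\<in>{1..k}. 1 + (s n - v n j)) - 1) * (L + K)
      + (\<Prod>j\<in>{1..k}. 1 + (s n - v n j)) * V / L
      + (((\<Prod>j\<in>{1..k}. 1 + (s n - r)) - 1) * (L + K)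
      + (\<Prod>j\<in>{1..k}. 1 + (s n - r)) * V / L)" for n L
  have ub: "\<bar>cexp k (v n) g - h_fun k g r\<bar> \<le> u n L" if "0 < L" for n L
    using diff[OF v s(1,2) vs that, of n] diff[OF admissible_const[OF r] s(1,2) s(3) that, of n]
    unfolding u_def h_fun_def by linarith
  have ulim: "(\<lambda>n. u n L) \<longlonglongrightarrow> (((\<Prod>j\<in>{1..k}. 1 + (r - r)) - 1) * (L + K)
      + (\<Prod>j\<in>{1..k}. 1 + (r - r)) * V / L
      + (((\<Prod>j\<in>{1..k}. 1 + (r - r)) - 1) * (L + K)
      + (\<Prod>j\<in>{1..k}. 1 + (r - r)) * V / L))" if "0 < L" for L
    unfolding u_def using that by (intro tendsto_intros slim lim) auto
  show ?thesis
  proof (rule tendstoI)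
    fix e :: real assume "0 < e"
    \<comment> \<open>The numerator makes \<open>e * L\<close> equal to \<open>2 * V + 1\<close>, so
      the limiting error \<open>2 * V / L\<close> is strictly below \<open>e\<close>.\<close>
    define L where "L = (2 * V + 1) / e"
    have L: "0 < L" using V \<open>0 < e\<close> by (simp add: L_def add_nonneg_pos)
    have "V + V < e * L" using \<open>0 < e\<close> by (simp add: L_def)
    then have "V / L + V / L < e" using L by (simp add: add_divide_distrib[symmetric] pos_divide_less_eq)
    then have "\<forall>\<^sub>F n in sequentially. u n L < e"
      using ulim[OF L] by (intro order_tendstoD(2)[OF ulim[OF L]]) simp
    then show "\<forall>\<^sub>F n in sequentially. dist (cexp k (v n) g) (h_fun k g r) < e"
    proof (rule eventually_mono)
      fix n assume "u n L < e"
      then show "dist (cexp k (v n) g) (h_fun k g r) < e" using ub[OF L, of n] by (simp add: dist_real_def)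
    qed
  qed
qed

end

section \<open>Averages and empirical quantiles\<close>

lemma eventually_le_mult_real:
  assumes "0 < d"
  shows "\<forall>\<^sub>F N in sequentially. c \<le> d * real N"
  using eventually_ge_at_top[of "nat \<lceil>c / d\<rceil>"]
proof (rule eventually_mono)
  fix N assume "nat \<lceil>c / d\<rceil> \<le> N"
  then have "c / d \<le> real N" by linarith
  then show "c \<le> d * real N" using assms by (simp add: field_simps)
qed

lemma nat_floor_bounds:
  fixes y :: real
  assumes "0 \<le> y"
  shows "real (nat \<lfloor>y\<rfloor>) \<le> y" "y < real (nat \<lfloor>y\<rfloor>) + 1"
  using assms by linarith+

lemma step_function_integral:
  fixes u :: "nat \<Rightarrow> real"
  assumes "1 \<le> N"
  shows "integrable lborel (\<lambda>x. indicator {0..<1} x * u (nat \<lfloor>x * real N\<rfloor>))"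
    and "(\<integral>x. indicator {0..<1} x * u (nat \<lfloor>x * real N\<rfloor>) \<partial>lborel) = (\<Sum>i<N. u i) / N"
proof -
  define J where "J i = {real i / N..<real (Suc i) / N}" for i
  have eq: "indicator {0..<1} x * u (nat \<lfloor>x * real N\<rfloor>) = (\<Sum>i<N. u i * indicator (J i) x)" for x :: real
  proof -
    have J: "x \<in> J i \<longleftrightarrow> real i \<le> x * N \<and> x * N < real i + 1" for i
      using assms by (auto simp: J_def field_simps)
    define n where "n = nat \<lfloor>x * real N\<rfloor>"
    have "indicator {0..<1} x * u n = (\<Sum>i<N. u i * indicator (J i) x)"
    proof (cases "0 \<le> x \<and> x < 1")
      case True
      have xN: "0 \<le> x * N" "x * N < N" using True assms by auto
      note f = nat_floor_bounds[OF xN(1), folded n_def]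
      have "real n < real N" using f(1) xN(2) by simp
      then have "n < N" by simp
      have "x \<in> J i \<longleftrightarrow> i = n" for i
      proof
        assume "x \<in> J i"
        then have i: "real i \<le> x * N" "x * N < real i + 1" unfolding J by auto
        have "real i < real n + 1" "real n < real i + 1"
          by (rule le_less_trans[OF i(1) f(2)], rule le_less_trans[OF f(1) i(2)])
        then show "i = n" by linarith
      qed (use f in \<open>simp add: J\<close>)
      then have "(\<Sum>i<N. u i * indicator (J i) x) = (\<Sum>i<N. if i = n then u i else 0)"
        by (intro sum.cong) (auto simp: indicator_def)
      then show ?thesis using True \<open>n < N\<close> by simp
    next
      case False
      have "x \<notin> J i" if "i < N" for i
      proof
        assume "x \<in> J i"
        moreover have "real i + 1 \<le> real N" "0 \<le> real i" using that by auto
        ultimately have "0 \<le> x * N" "x * N < 1 * N" unfolding J by linarith+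
        then show False using False assms by (auto simp: zero_le_mult_iff)
      qed
      then show ?thesis using False by auto
    qed
    then show ?thesis unfolding n_def .
  qed
  have I: "integrable lborel (\<lambda>x. u i * indicator (J i) x)" for i
    using divide_right_mono[of "real i" "real (Suc i)" "real N"]
    unfolding J_def by (intro integrable_mult_right integrable_real_indicator) auto
  show "integrable lborel (\<lambda>x. indicator {0..<1} x * u (nat \<lfloor>x * real N\<rfloor>))"
    unfolding eq by (intro Bochner_Integration.integrable_sum I)
  have "measure lborel (J i) = 1 / N" for i
    using assms divide_right_mono[of "real i" "real (Suc i)" "real N"]
    by (simp add: J_def measure_def diff_divide_distrib[symmetric])
  then have "(\<integral>x. u i * indicator (J i) x \<partial>lborel) = u i / N" for i
    by (simp add: J_def)
  then show "(\<integral>x. indicator {0..<1} x * u (nat \<lfloor>x * real N\<rfloor>) \<partial>lborel) = (\<Sum>i<N. u i) / N"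
    unfolding eq Bochner_Integration.integral_sum[OF I] by (simp only: sum_divide_distrib)
qed

text \<open>Each average is the integral of a step function bounded by \<open>C\<close>, so
  pointwise convergence suffices. Measurability of \<open>f\<close> on the interval comes along as
  that of a pointwise limit.\<close>

lemma averages_tendsto_integral:
  fixes u :: "nat \<Rightarrow> nat \<Rightarrow> real"
  assumes bnd: "\<And>N i. \<bar>u N i\<bar> \<le> C"
    and lim: "\<And>x. 0 \<le> x \<Longrightarrow> x < 1 \<Longrightarrow> (\<lambda>N. u N (nat \<lfloor>x * real N\<rfloor>)) \<longlonglongrightarrow> f x"
  shows "(\<lambda>N. (\<Sum>i<N. u N i) / N) \<longlonglongrightarrow> (LBINT x:{0..1}. f x)"
proof -
  define n where "n x N = nat \<lfloor>x * real N\<rfloor>" for x :: real and N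
  note lim = lim[folded n_def] and step = step_function_integral[folded n_def]
  \<comment> \<open>The hypothesis is silent at \<open>x = 1\<close>. Prescribing \<open>f 1\<close>
    there gives convergence at every point without changing the integral. The index
    \<open>Suc N\<close> avoids a division into zero cells.\<close>
  define s where "s N x = indicator {0..<1} x * u (Suc N) (n x (Suc N)) + indicator {1} x * f 1"
    for N and x :: real
  have s1: "integrable lborel (\<lambda>x. indicator {1::real} x * f 1)"
    by (intro integrable_mult_left integrable_real_indicator) auto
  have s_int: "integrable lborel (s N)" for N
    unfolding s_def by (intro Bochner_Integration.integrable_add step s1) simp
  have s_lim: "(\<lambda>N. s N x) \<longlonglongrightarrow> indicator {0..1} x * f x" for x
  proof (cases "0 \<le> x \<and> x < 1")
    case True
    then have "(\<lambda>N. s N x) = (\<lambda>N. u (Suc N) (n x (Suc N)))" by (auto simp: s_def)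
    then show ?thesis using LIMSEQ_Suc[OF lim[of x]] True by simp
  next
    case False
    then have "(\<lambda>N. s N x) = (\<lambda>N. indicator {0..1} x * f x)"
      by (cases "x = 1") (auto simp: s_def fun_eq_iff indicator_def)
    then show ?thesis by simp
  qed
  have meas: "(\<lambda>x. indicator {0..1} x * f x) \<in> borel_measurable lborel"
    by (rule borel_measurable_LIMSEQ_real[OF s_lim borel_measurable_integrable[OF s_int]])
  have w: "integrable lborel (\<lambda>x. indicator {0..1::real} x * (C + \<bar>f 1\<bar>))"
    by (intro integrable_mult_left integrable_real_indicator) auto
  have bound: "\<bar>indicator {0..<1} x * v + indicator {1} x * f 1\<bar> \<le> indicator {0..1} x * (C + \<bar>f 1\<bar>)"
    if "\<bar>v\<bar> \<le> C" for v x :: real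
    using that by (auto simp: indicator_def)
  have sw: "norm (s N x) \<le> indicator {0..1} x * (C + \<bar>f 1\<bar>)" for N x
    unfolding s_def real_norm_def by (rule bound[OF bnd])
  have "(\<lambda>N. integral\<^sup>L lborel (s N)) \<longlonglongrightarrow> (\<integral>x. indicator {0..1} x * f x \<partial>lborel)"
    by (rule integral_dominated_convergence[OF meas borel_measurable_integrable[OF s_int] w])
      (simp_all only: s_lim sw eventually_True)
  moreover have "integral\<^sup>L lborel (s N) = (\<Sum>i<Suc N. u (Suc N) i) / Suc N" for N
  proof -
    have N: "1 \<le> Suc N" by simp
    have "integral\<^sup>L lborel (s N) = (\<integral>x. indicator {0..<1} x * u (Suc N) (n x (Suc N)) \<partial>lborel)
        + (\<integral>x. indicator {1::real} x * f 1 \<partial>lborel)"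
      unfolding s_def by (rule Bochner_Integration.integral_add[OF step(1)[OF N] s1])
    also have "(\<integral>x. indicator {1::real} x * f 1 \<partial>lborel) = 0" by simp
    finally show ?thesis unfolding step(2)[OF N] by (simp only: add_0_right)
  qed
  ultimately have "(\<lambda>N. (\<Sum>i<Suc N. u (Suc N) i) / Suc N) \<longlonglongrightarrow> (\<integral>x. indicator {0..1} x * f x \<partial>lborel)"
    by simp
  then show ?thesis
    unfolding set_lebesgue_integral_def real_scaleR_def by (rule LIMSEQ_imp_Suc)
qed

lemma floor_quotient_tendsto:
  fixes x :: real
  assumes "0 \<le> x" "x \<le> 1"
  shows "(\<lambda>N. real (nat \<lfloor>x * real N\<rfloor>) / real (N + 1)) \<longlonglongrightarrow> x"
proof (rule LIM_zero_cancel, rule Lim_null_comparison)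
  show "\<forall>\<^sub>F N in sequentially. norm (real (nat \<lfloor>x * real N\<rfloor>) / real (N + 1) - x) \<le> 2 * inverse (real (Suc N))"
  proof (intro always_eventually allI)
    fix N
    define y where "y = x * real N"
    have "x * real (N + 1) = y + x" "0 \<le> y" using assms by (simp_all add: y_def algebra_simps)
    then have "\<bar>real (nat \<lfloor>y\<rfloor>) - x * real (N + 1)\<bar> \<le> 2"
      using assms nat_floor_bounds[of y] by linarith
    then have "\<bar>real (nat \<lfloor>x * real N\<rfloor>) - x * real (N + 1)\<bar> \<le> 2"
      unfolding y_def .
    then have "\<bar>real (nat \<lfloor>x * real N\<rfloor>) - x * real (N + 1)\<bar> / real (N + 1) \<le> 2 / real (N + 1)"
      by (intro divide_right_mono) auto
    also have "\<bar>real (nat \<lfloor>x * real N\<rfloor>) - x * real (N + 1)\<bar> / real (N + 1)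
        = \<bar>real (nat \<lfloor>x * real N\<rfloor>) / real (N + 1) - x\<bar>"
      by (subst abs_div_pos) (simp_all add: diff_divide_distrib)
    finally show "norm (real (nat \<lfloor>x * real N\<rfloor>) / real (N + 1) - x) \<le> 2 * inverse (real (Suc N))"
      by (simp add: divide_inverse)
  qed
  show "(\<lambda>N. 2 * inverse (real (Suc N))) \<longlonglongrightarrow> 0"
    using tendsto_mult_right_zero[OF LIMSEQ_inverse_real_of_nat, of 2] by simp
qed

text \<open>For an ordered vector, entry \<open>m\<close> is at most \<open>q\<close> exactly when
  at least \<open>m\<close> entries are. The limiting distribution function is strictly increasing,
  so its convergence can be inverted. Testing rational levels keeps the exceptional events countable
  in the application.\<close>

lemma empirical_quantile_tendsto:
  assumes ab: "a < b" and adm: "\<And>N. 1 \<le> N \<Longrightarrow> admissible a b N (\<theta> N)"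
    and cdf: "\<And>q. q \<in> \<rat> \<Longrightarrow> a < q \<Longrightarrow> q < b \<Longrightarrow>
      (\<lambda>N. real (card {i \<in> {1..N}. \<theta> N i \<le> q}) / N) \<longlonglongrightarrow> (q - a) / (b - a)"
    and x: "0 \<le> x" "x < 1" and j: "1 \<le> j"
  shows "(\<lambda>N. \<theta> N (nat \<lfloor>x * real N\<rfloor> + j)) \<longlonglongrightarrow> rho a b x"
proof -
  have mono: "\<theta> N i \<le> \<theta> N i'" if "1 \<le> N" "i \<in> {1..N}" "i' \<in> {1..N}" "i \<le> i'" for N i i'
    using adm[OF that(1)] that unfolding admissible_def mono_on_def by blast
  define n where "n N = nat \<lfloor>x * real N\<rfloor>" for N
  define m where "m N = n N + j" for N
  have xN: "0 \<le> x * real N" for N using x by simp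
  have n: "real (n N) \<le> x * N" "x * N < real (n N) + 1" for N
    unfolding n_def by (rule nat_floor_bounds(1)[OF xN], rule nat_floor_bounds(2)[OF xN])
  have m: "x * real N < m N" "m N \<le> x * real N + j" for N
    using n[of N] j unfolding m_def by simp_all
  have "\<forall>\<^sub>F N in sequentially. real j \<le> (1 - x) * real N"
    using x by (intro eventually_le_mult_real) simp
  then have idx: "\<forall>\<^sub>F N in sequentially. 1 \<le> N \<and> m N \<in> {1..N}"
    using eventually_ge_at_top[of 1]
  proof eventually_elim
    case (elim N)
    then have "real (m N) \<le> N" using m(2)[of N] by (simp add: algebra_simps)
    then show ?case using elim j by (simp add: m_def)
  qed
  have "0 \<le> (b - a) * x" "(b - a) * x < b - a"
    using ab x by simp_all
  then have rb: "a \<le> rho a b x" "rho a b x < b"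
    unfolding rho_def by linarith+
  have inner: "(q - a) / (b - a) < x \<longleftrightarrow> q < rho a b x" "x < (q - a) / (b - a) \<longleftrightarrow> rho a b x < q" for q
    using ab by (auto simp: rho_def field_simps)
  show ?thesis unfolding n_def[symmetric] m_def[symmetric]
  proof (rule order_tendstoI)
    fix l assume l: "l < rho a b x"
    show "\<forall>\<^sub>F N in sequentially. l < \<theta> N (m N)"
    proof (cases "max l a < rho a b x")
      case True
      then obtain q where q: "q \<in> \<rat>" "max l a < q" "q < rho a b x" using Rats_dense_in_real by blast
      have "\<forall>\<^sub>F N in sequentially. real (card {i \<in> {1..N}. \<theta> N i \<le> q}) / N < x"
        using q rb by (intro order_tendstoD(2)[OF cdf]) (auto simp: inner)
      with idx show ?thesis
      proof eventually_elim
        case (elim N)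
        \<comment> \<open>Otherwise the first \<open>m N\<close> entries would all be at most
          \<open>q\<close>, a proportion exceeding \<open>x\<close>; that \<open>m N\<close> exceeds
          \<open>x * N\<close> relies on \<open>1 \<le> j\<close>.\<close>
        have "\<not> \<theta> N (m N) \<le> q"
        proof
          assume le: "\<theta> N (m N) \<le> q"
          have "{1..m N} \<subseteq> {i \<in> {1..N}. \<theta> N i \<le> q}"
          proof
            fix i assume i: "i \<in> {1..m N}"
            then have "\<theta> N i \<le> \<theta> N (m N)" using elim by (intro mono) auto
            then show "i \<in> {i \<in> {1..N}. \<theta> N i \<le> q}" using i elim le by auto
          qed
          then have "card {1..m N} \<le> card {i \<in> {1..N}. \<theta> N i \<le> q}" by (intro card_mono) auto
          then have "m N \<le> card {i \<in> {1..N}. \<theta> N i \<le> q}" by simp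
          then have "real (m N) / N \<le> real (card {i \<in> {1..N}. \<theta> N i \<le> q}) / N"
            by (intro divide_right_mono) auto
          then have "real (m N) / N < x" using elim by linarith
          then show False using m(1)[of N] elim by (simp add: field_simps)
        qed
        then show ?case using q by simp
      qed
    next
      case False
      \<comment> \<open>In this case \<open>rho a b x = a\<close>, so there is no level between
        \<open>a\<close> and the limit; the lower bound on the entries replaces the counting
        argument.\<close>
      then have "l < a" using l rb by simp
      from idx show ?thesis
      proof eventually_elim
        case (elim N)
        then have "a \<le> \<theta> N (m N)" using adm[of N] unfolding admissible_def by blast
        then show ?case using \<open>l < a\<close> by simp
      qed
    qed
  next
    fix r assume r: "rho a b x < r"
    then obtain q where q: "q \<in> \<rat>" "rho a b x < q" "q < min r b"
      using Rats_dense_in_real[of "rho a b x" "min r b"] rb by auto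
    \<comment> \<open>The gap between \<open>x\<close> and \<open>y\<close> absorbs the fixed offset
      \<open>j\<close>: eventually \<open>x * N + j\<close> is at most \<open>y * N\<close>, hence
      so is \<open>m N\<close>.\<close>
    obtain y where y: "x < y" "y < (q - a) / (b - a)" using dense inner(2) q by blast
    have "\<forall>\<^sub>F N in sequentially. y < real (card {i \<in> {1..N}. \<theta> N i \<le> q}) / N"
      using q rb y by (intro order_tendstoD(1)[OF cdf]) auto
    moreover have "\<forall>\<^sub>F N in sequentially. real j \<le> (y - x) * real N"
      using y by (intro eventually_le_mult_real) simp
    ultimately show "\<forall>\<^sub>F N in sequentially. \<theta> N (m N) < r" using idx
    proof eventually_elim
      case (elim N)
      have "\<theta> N (m N) \<le> q"
      proof (rule ccontr)
        assume "\<not> \<theta> N (m N) \<le> q"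
        then have "i \<le> m N" if "i \<in> {1..N}" "\<theta> N i \<le> q" for i
          using mono[of N "m N" i] elim that by force
        then have "{i \<in> {1..N}. \<theta> N i \<le> q} \<subseteq> {1..m N}" by auto
        then have "card {i \<in> {1..N}. \<theta> N i \<le> q} \<le> card {1..m N}" by (intro card_mono) auto
        then have "card {i \<in> {1..N}. \<theta> N i \<le> q} \<le> m N" by simp
        moreover have "y * N < real (card {i \<in> {1..N}. \<theta> N i \<le> q})"
          using elim by (simp add: field_simps)
        ultimately show False using m(2)[of N] elim by (simp add: algebra_simps)
      qed
      then show ?case using q by simp
    qed
  qed
qed

section \<open>Passing from conditional to unconditional probabilities\<close>

text \<open>Borel--Cantelli at the thresholds \<open>1 / (j + 1)\<close>. The variables with
  different indices may depend on each other arbitrarily, as the coupling of the system sizes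
  requires.\<close>

lemma (in prob_space) AE_tendsto_zero_of_summable_tails:
  fixes D :: "nat \<Rightarrow> 'a \<Rightarrow> real"
  assumes [measurable]: "\<And>n. D n \<in> borel_measurable M"
    and s: "\<And>\<delta>. 0 < \<delta> \<Longrightarrow> \<exists>s. summable s \<and>
      (\<forall>\<^sub>F n in sequentially. prob {\<omega> \<in> space M. \<delta> < \<bar>D n \<omega>\<bar>} \<le> s n)"
  shows "AE \<omega> in M. (\<lambda>n. D n \<omega>) \<longlonglongrightarrow> 0"
proof -
  have "AE \<omega> in M. \<forall>\<^sub>F n in sequentially. \<bar>D n \<omega>\<bar> \<le> \<delta>" if \<delta>: "0 < \<delta>" for \<delta>
  proof -
    obtain s where s: "summable s" "\<forall>\<^sub>F n in sequentially. prob {\<omega> \<in> space M. \<delta> < \<bar>D n \<omega>\<bar>} \<le> s n"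
      using s[OF \<delta>] by blast
    have "\<forall>\<^sub>F n in sequentially. norm (prob {\<omega> \<in> space M. \<delta> < \<bar>D n \<omega>\<bar>}) \<le> s n"
      using s(2) by simp
    then have "summable (\<lambda>n. prob {\<omega> \<in> space M. \<delta> < \<bar>D n \<omega>\<bar>})"
      using s(1) by (rule summable_comparison_test_ev)
    then have "AE \<omega> in M. \<forall>\<^sub>F n in sequentially. \<omega> \<in> space M - {\<omega> \<in> space M. \<delta> < \<bar>D n \<omega>\<bar>}"
      by (intro borel_cantelli_AE1) (auto simp: emeasure_eq_measure)
    then show ?thesis
      by eventually_elim (auto elim!: eventually_mono)
  qed
  then have "AE \<omega> in M. \<forall>j. \<forall>\<^sub>F n in sequentially. \<bar>D n \<omega>\<bar> \<le> inverse (real (Suc j))"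
    by (subst AE_all_countable) (auto simp del: of_nat_Suc)
  then show ?thesis
  proof eventually_elim
    case (elim \<omega>)
    show ?case
    proof (rule tendstoI)
      fix e :: real assume "0 < e"
      then obtain j where "inverse (real (Suc j)) < e" using reals_Archimedean by blast
      then show "\<forall>\<^sub>F n in sequentially. dist (D n \<omega>) 0 < e"
        using elim[rule_format, of j] by (auto elim!: eventually_mono)
    qed
  qed
qed

lemma countable_finite_support: "countable {x :: nat \<Rightarrow> nat. \<forall>j. j \<notin> {1..N} \<longrightarrow> x j = 0}"
proof (rule countable_subset)
  show "{x :: nat \<Rightarrow> nat. \<forall>j. j \<notin> {1..N} \<longrightarrow> x j = 0} \<subseteq> (\<lambda>xs j. if j \<in> {1..N} then xs ! j else 0) ` UNIV"
  proof
    fix x :: "nat \<Rightarrow> nat" assume "x \<in> {x. \<forall>j. j \<notin> {1..N} \<longrightarrow> x j = 0}"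
    then have "x j = (if j \<in> {1..N} then map x [0..<Suc N] ! j else 0)" for j
      by (cases "j \<in> {1..N}") (auto simp del: upt_Suc)
    then have "x = (\<lambda>xs j. if j \<in> {1..N} then xs ! j else 0) (map x [0..<Suc N])"
      by (rule ext)
    then show "x \<in> (\<lambda>xs j. if j \<in> {1..N} then xs ! j else 0) ` UNIV" by blast
  qed
qed simp

text \<open>Reproduces the normalization inside \<open>conditional_config_law\<close>: sites outside
  \<open>{1..N}\<close> carry the default value 0 of the product law.\<close>

definition truncate_config :: "nat \<Rightarrow> (nat \<Rightarrow> nat) \<Rightarrow> nat \<Rightarrow> nat" where
  "truncate_config N e = (\<lambda>i. if i \<in> {1..N} then e i else 0)"

text \<open>
  The variable \<open>m\<close> is the conditional expectation of \<open>f\<close> assembled from the conditional probabilities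
  of the countably many configurations, which makes its measurability automatic.
\<close>

lemma (in prob_space) conditional_config_law_deviation:
  fixes f :: "(nat \<Rightarrow> nat) \<Rightarrow> real"
  assumes T: "\<And>i. i \<in> {1..N} \<Longrightarrow> T i \<in> borel_measurable M"
    and e: "\<And>i. i \<in> {1..N} \<Longrightarrow> e i \<in> measurable M (count_space UNIV)"
    and cond: "conditional_config_law M N T e"
  obtains m where "m \<in> borel_measurable M"
    and "(\<lambda>\<omega>. f (truncate_config N (\<lambda>i. e i \<omega>))) \<in> borel_measurable M"
    and "AE \<omega> in M. m \<omega> = cexp N (\<lambda>i. T i \<omega>) f"
    and "\<forall>\<delta>. \<forall>c\<ge>0.
      (AE \<omega> in M. measure_pmf.prob (config_law N (\<lambda>i. T i \<omega>)) {x. \<delta> < \<bar>f x - cexp N (\<lambda>i. T i \<omega>) f\<bar>} \<le> c)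
      \<longrightarrow> prob {\<omega> \<in> space M. \<delta> < \<bar>f (truncate_config N (\<lambda>i. e i \<omega>)) - m \<omega>\<bar>} \<le> c"
proof -
  define F where "F = vec_algebra M N T"
  define D where "D = {x :: nat \<Rightarrow> nat. \<forall>j. j \<notin> {1..N} \<longrightarrow> x j = 0}"
  define conf where "conf \<omega> = truncate_config N (\<lambda>i. e i \<omega>)" for \<omega>
  have cD: "countable D" unfolding D_def by (rule countable_finite_support)
  have confD: "conf \<omega> \<in> D" for \<omega> by (auto simp: conf_def D_def truncate_config_def)
  have Tm: "(\<lambda>\<omega>. \<lambda>i\<in>{1..N}. T i \<omega>) \<in> measurable M (PiM {1..N} (\<lambda>_. borel))"
    using T by (intro measurable_restrict) auto
  have sub: "subalgebra M F"
    unfolding subalgebra_def F_def vec_algebra_def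
    using measurable_sets[OF Tm] measurable_space[OF Tm]
    by (auto simp: sets_vimage_algebra2 Pi_iff)
  interpret finite_measure_subalgebra M F by standard (rule sub)
  have Ex: "{\<omega> \<in> space M. conf \<omega> = x} \<in> sets M" for x
  proof (cases "x \<in> D")
    case True
    have "{\<omega> \<in> space M. conf \<omega> = x} = {\<omega> \<in> space M. \<forall>i\<in>{1..N}. e i \<omega> = x i}"
      using True by (auto simp: conf_def truncate_config_def D_def fun_eq_iff)
    also have "\<dots> \<in> sets M"
    proof (rule sets.sets_Collect_finite_All)
      fix i assume i: "i \<in> {1..N}"
      show "{\<omega> \<in> space M. e i \<omega> = x i} \<in> sets M"
        using measurable_sets[OF e[OF i], of "{x i}"] by (simp add: vimage_def Int_def conj_commute)
    qed auto
    finally show ?thesis .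
  next
    case False
    then have "{\<omega> \<in> space M. conf \<omega> = x} = {}" using confD by auto
    then show ?thesis by (simp only: sets.empty_sets)
  qed
  have conf_meas: "conf \<in> measurable M (count_space D)"
    using confD Ex by (subst measurable_count_space_eq_countable[OF cD]) (auto simp: vimage_def Int_def conj_commute)
  have f_meas: "(\<lambda>\<omega>. f (conf \<omega>)) \<in> borel_measurable M"
    by (rule measurable_compose[OF conf_meas]) simp
  define E where "E x = {\<omega> \<in> space M. conf \<omega> = x}" for x
  have [measurable]: "E x \<in> sets M" for x using Ex by (simp add: E_def)
  define r where "r x = real_cond_exp M F (indicat_real (E x))" for x
  have r_F [measurable]: "r x \<in> borel_measurable F" for x
    unfolding r_def by (rule borel_measurable_cond_exp)
  have r_M [measurable]: "r x \<in> borel_measurable M" for x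
    by (rule measurable_from_subalg[OF sub r_F])
  have "AE \<omega> in M. r x \<omega> = pmf (config_law N (\<lambda>i. T i \<omega>)) x" for x
    using cond[unfolded conditional_config_law_def, rule_format, of "{x}"]
    by (simp add: r_def E_def F_def conf_def truncate_config_def measure_pmf_single)
  then have r_eq: "AE \<omega> in M. \<forall>x\<in>D. r x \<omega> = pmf (config_law N (\<lambda>i. T i \<omega>)) x"
    by (subst AE_ball_countable[OF cD]) blast
  \<comment> \<open>The sum runs over the countable set \<open>D\<close> that carries the law. Being
    built from versions of the conditional probabilities, \<open>m\<close> is measurable with
    respect to \<open>F\<close>, that is, determined by the parameters.\<close>
  define m where "m \<omega> = (\<integral>x. r x \<omega> * f x \<partial>count_space D)" for \<omega>
  interpret D: sigma_finite_measure "count_space D"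
    by (rule sigma_finite_measure_count_space_countable[OF cD])
  have m_F [measurable]: "m \<in> borel_measurable F"
    unfolding m_def
  proof (rule D.borel_measurable_lebesgue_integral)
    have "(\<lambda>p. r (snd p) (fst p) * f (snd p)) \<in> borel_measurable (F \<Otimes>\<^sub>M count_space D)"
      by (rule measurable_compose_countable'[OF _ measurable_snd cD]) measurable
    then show "(\<lambda>(\<omega>, x). r x \<omega> * f x) \<in> borel_measurable (F \<Otimes>\<^sub>M count_space D)"
      by (simp add: case_prod_beta)
  qed
  have m_M [measurable]: "m \<in> borel_measurable M"
    by (rule measurable_from_subalg[OF sub m_F])
  have supp: "pmf (config_law N \<theta>) x = 0" if "x \<notin> D" for x \<theta>
    using that unfolding config_law_def D_def by (intro pmf_Pi_outside) auto
  have m_eq: "AE \<omega> in M. m \<omega> = cexp N (\<lambda>i. T i \<omega>) f"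
    using r_eq
  proof eventually_elim
    case (elim \<omega>)
    have "m \<omega> = infsetsum (\<lambda>x. pmf (config_law N (\<lambda>i. T i \<omega>)) x * f x) D"
      unfolding m_def infsetsum_def using elim by (intro Bochner_Integration.integral_cong) auto
    also have "\<dots> = infsetsum (\<lambda>x. pmf (config_law N (\<lambda>i. T i \<omega>)) x * f x) UNIV"
      using supp by (intro infsetsum_cong_neutral) auto
    finally show ?case by (simp add: cexp_def pmf_expectation_eq_infsetsum)
  qed
  have "prob {\<omega> \<in> space M. \<delta> < \<bar>f (conf \<omega>) - m \<omega>\<bar>} \<le> c"
    if c: "0 \<le> c" and dev: "AE \<omega> in M. measure_pmf.prob (config_law N (\<lambda>i. T i \<omega>))
        {x. \<delta> < \<bar>f x - cexp N (\<lambda>i. T i \<omega>) f\<bar>} \<le> c" for \<delta> c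
  proof -
    \<comment> \<open>With the configuration frozen at \<open>x\<close>, the deviation event is
      determined by the parameters, so its indicator can be pulled out of the conditional
      expectation of the indicator of \<open>E x\<close>.\<close>
    define G where "G x = {\<omega> \<in> space F. \<delta> < \<bar>f x - m \<omega>\<bar>}" for x
    have G_F [measurable]: "G x \<in> sets F" for x unfolding G_def by measurable
    have sF: "space F = space M" using sub by (simp add: subalgebra_def)
    have [measurable]: "G x \<in> sets M" for x using G_F[of x] sub by (auto simp: subalgebra_def)
    have part: "emeasure M (E x \<inter> G x) = (\<integral>\<^sup>+\<omega>. ennreal (indicator (G x) \<omega> * r x \<omega>) \<partial>M)" if "x \<in> D" for x
    proof -
      have "integrable M (\<lambda>\<omega>. indicat_real (G x) \<omega> * indicat_real (E x) \<omega>)"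
        by (rule integrable_real_bounded[where K = 1]) (auto simp: indicator_def)
      note intg = real_cond_exp_intg[OF this, folded r_def]
      have "emeasure M (E x \<inter> G x) = ennreal (\<integral>\<omega>. indicat_real (G x) \<omega> * indicat_real (E x) \<omega> \<partial>M)"
        by (simp add: emeasure_eq_measure indicator_inter_arith[symmetric] Int_commute)
      also have "\<dots> = ennreal (\<integral>\<omega>. indicat_real (G x) \<omega> * r x \<omega> \<partial>M)"
        by (subst intg(2)) auto
      also have "\<dots> = (\<integral>\<^sup>+\<omega>. ennreal (indicator (G x) \<omega> * r x \<omega>) \<partial>M)"
      proof (rule nn_integral_eq_integral[symmetric])
        show "AE \<omega> in M. 0 \<le> indicat_real (G x) \<omega> * r x \<omega>"
          using r_eq by eventually_elim (use that in auto)
      qed (use intg(1) in auto)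
      finally show ?thesis .
    qed
    interpret MD: pair_sigma_finite M "count_space D" by standard
    have joint: "(\<lambda>(\<omega>, x). ennreal (indicator (G x) \<omega> * r x \<omega>)) \<in> borel_measurable (M \<Otimes>\<^sub>M count_space D)"
    proof -
      have "(\<lambda>p. ennreal (indicator (G (snd p)) (fst p) * r (snd p) (fst p))) \<in> borel_measurable (M \<Otimes>\<^sub>M count_space D)"
        by (rule measurable_compose_countable'[OF _ measurable_snd cD]) measurable
      then show ?thesis by (simp add: case_prod_beta)
    qed
    have EG: "E x \<inter> G x \<in> sets M" for x by measurable
    have disj: "disjoint_family_on (\<lambda>x. E x \<inter> G x) D" by (auto simp: disjoint_family_on_def E_def)
    have "{\<omega> \<in> space M. \<delta> < \<bar>f (conf \<omega>) - m \<omega>\<bar>} = (\<Union>x\<in>D. E x \<inter> G x)"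
      using confD sF by (auto simp: E_def G_def)
    then have "emeasure M {\<omega> \<in> space M. \<delta> < \<bar>f (conf \<omega>) - m \<omega>\<bar>}
        = (\<integral>\<^sup>+x. emeasure M (E x \<inter> G x) \<partial>count_space D)"
      by (simp only:) (intro emeasure_UN_countable cD EG disj)
    also have "\<dots> = (\<integral>\<^sup>+x. (\<integral>\<^sup>+\<omega>. ennreal (indicator (G x) \<omega> * r x \<omega>) \<partial>M) \<partial>count_space D)"
      by (intro nn_integral_cong part) simp
    \<comment> \<open>After the interchange the inner sum over configurations is the conditional
      probability of a deviation, which \<open>dev\<close> bounds by \<open>c\<close> almost
      surely.\<close>
    also have "\<dots> = (\<integral>\<^sup>+\<omega>. (\<integral>\<^sup>+x. ennreal (indicator (G x) \<omega> * r x \<omega>) \<partial>count_space D) \<partial>M)"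
      by (rule MD.Fubini'[OF joint])
    also have "\<dots> \<le> (\<integral>\<^sup>+\<omega>. ennreal c \<partial>M)"
    proof (rule nn_integral_mono_AE)
      show "AE \<omega> in M. (\<integral>\<^sup>+x. ennreal (indicator (G x) \<omega> * r x \<omega>) \<partial>count_space D) \<le> ennreal c"
        using r_eq m_eq dev AE_space
      proof eventually_elim
        case (elim \<omega>)
        let ?Q = "config_law N (\<lambda>i. T i \<omega>)" and ?S = "{x. \<delta> < \<bar>f x - cexp N (\<lambda>i. T i \<omega>) f\<bar>}"
        have "(\<integral>\<^sup>+x. ennreal (indicator (G x) \<omega> * r x \<omega>) \<partial>count_space D)
            = (\<integral>\<^sup>+x. ennreal (pmf ?Q x) * indicator ?S x \<partial>count_space D)"
          using elim sF by (intro nn_integral_cong) (auto simp: G_def indicator_def)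
        also have "\<dots> \<le> (\<integral>\<^sup>+x. ennreal (pmf ?Q x) * indicator ?S x \<partial>count_space UNIV)"
          by (subst nn_integral_count_space_indicator) (auto intro!: nn_integral_mono simp: indicator_def)
        also have "\<dots> = (\<integral>\<^sup>+x. ennreal (pmf ?Q x) \<partial>count_space ?S)"
          by (subst nn_integral_count_space_indicator[of ?S]) auto
        also have "\<dots> = emeasure ?Q ?S" by (rule nn_integral_pmf)
        also have "\<dots> \<le> ennreal c"
          using elim by (auto simp: measure_pmf.emeasure_eq_measure intro!: ennreal_leI)
        finally show ?case .
      qed
    qed
    also have "\<dots> = ennreal c" by (simp add: emeasure_space_1)
    finally show ?thesis using c by (simp add: emeasure_eq_measure)
  qed
  then have "\<forall>\<delta>. \<forall>c\<ge>0.
      (AE \<omega> in M. measure_pmf.prob (config_law N (\<lambda>i. T i \<omega>)) {x. \<delta> < \<bar>f x - cexp N (\<lambda>i. T i \<omega>) f\<bar>} \<le> c)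
      \<longrightarrow> prob {\<omega> \<in> space M. \<delta> < \<bar>f (conf \<omega>) - m \<omega>\<bar>} \<le> c"
    by blast
  then show thesis
    by (rule that[OF m_M f_meas[unfolded conf_def] m_eq, folded conf_def])
qed

section \<open>Uniform order statistics\<close>

text \<open>In a sorted list the positions with entry at most \<open>t\<close> form an initial
  segment; positions count from 0, hence the strict inequality.\<close>

lemma sorted_nth_le_iff:
  fixes xs :: "'x::linorder list"
  assumes "sorted xs" "n < length xs"
  shows "xs ! n \<le> t \<longleftrightarrow> n < length (filter (\<lambda>x. x \<le> t) xs)"
proof -
  let ?S = "{i. i < length xs \<and> xs ! i \<le> t}"
  have card: "length (filter (\<lambda>x. x \<le> t) xs) = card ?S" by (rule length_filter_conv_card)
  show ?thesis
  proof
    assume le: "xs ! n \<le> t"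
    have "{..n} \<subseteq> ?S"
    proof
      fix i assume "i \<in> {..n}"
      then have "xs ! i \<le> xs ! n" using assms by (intro sorted_nth_mono) auto
      then show "i \<in> ?S" using le assms \<open>i \<in> {..n}\<close> by auto
    qed
    then have "card {..n} \<le> card ?S" by (intro card_mono) auto
    then show "n < length (filter (\<lambda>x. x \<le> t) xs)" using card by simp
  next
    assume less: "n < length (filter (\<lambda>x. x \<le> t) xs)"
    show "xs ! n \<le> t"
    proof (rule ccontr)
      assume gt: "\<not> xs ! n \<le> t"
      have "?S \<subseteq> {..<n}"
      proof
        fix i assume i: "i \<in> ?S"
        have "\<not> n \<le> i"
        proof
          assume "n \<le> i"
          then have "xs ! n \<le> xs ! i" using assms i by (intro sorted_nth_mono) auto
          then show False using gt i by auto
        qed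
        then show "i \<in> {..<n}" by simp
      qed
      then have "card ?S \<le> card {..<n}" by (intro card_mono) auto
      then show False using less card by simp
    qed
  qed
qed

lemma order_stat_le_iff:
  assumes "i \<in> {1..N}"
  shows "order_stat N u i \<le> t \<longleftrightarrow> i \<le> card {j \<in> {1..N}. u j \<le> t}"
proof -
  let ?l = "map u [1..<Suc N]"
  have "length (filter (\<lambda>x. x \<le> t) (sort ?l)) = length (filter (\<lambda>x. x \<le> t) ?l)"
    by (simp add: filter_sort del: upt_Suc)
  also have "\<dots> = length (filter (\<lambda>j. u j \<le> t) [1..<Suc N])"
    by (simp add: filter_map comp_def del: upt_Suc)
  also have "\<dots> = card (set (filter (\<lambda>j. u j \<le> t) [1..<Suc N]))"
    by (rule distinct_card[symmetric]) (simp del: upt_Suc)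
  also have "set (filter (\<lambda>j. u j \<le> t) [1..<Suc N]) = {j \<in> {1..N}. u j \<le> t}"
    by (auto simp del: upt_Suc)
  finally have c: "length (filter (\<lambda>x. x \<le> t) (sort ?l)) = card {j \<in> {1..N}. u j \<le> t}" .
  have "i - 1 < length (sort ?l)" using assms by auto
  then have "order_stat N u i \<le> t \<longleftrightarrow> i - 1 < card {j \<in> {1..N}. u j \<le> t}"
    unfolding order_stat_def c[symmetric] by (intro sorted_nth_le_iff) simp_all
  then show ?thesis using assms by auto
qed

text \<open>Sorting leaves the empirical distribution function unchanged, so questions about the
  dependent order statistics can be answered on the independent sample.\<close>

lemma card_order_stat_le: "card {i \<in> {1..N}. order_stat N u i \<le> t} = card {j \<in> {1..N}. u j \<le> t}"
proof -
  have "card {j \<in> {1..N}. u j \<le> t} \<le> card {1..N}" by (intro card_mono) auto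
  then have le: "card {j \<in> {1..N}. u j \<le> t} \<le> N" by simp
  have "{i \<in> {1..N}. order_stat N u i \<le> t} = {i \<in> {1..N}. i \<le> card {j \<in> {1..N}. u j \<le> t}}"
    by (intro Collect_cong conj_cong refl order_stat_le_iff)
  also have "\<dots> = {1..card {j \<in> {1..N}. u j \<le> t}}"
    using le by (intro equalityI subsetI) (simp_all only: mem_Collect_eq atLeastAtMost_iff, simp)
  finally show ?thesis by (simp only: card_atLeastAtMost diff_Suc_1 One_nat_def)
qed

lemma admissible_order_stat:
  assumes "\<And>j. j \<in> {1..N} \<Longrightarrow> a \<le> u j \<and> u j < b"
  shows "admissible a b N (order_stat N u)"
  unfolding admissible_def
proof (intro conjI ballI)
  fix i assume "i \<in> {1..N}"
  then have "order_stat N u i \<in> set (sort (map u [1..<Suc N]))"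
    unfolding order_stat_def by (intro nth_mem) auto
  also have "set (sort (map u [1..<Suc N])) = u ` {1..N}"
    by (simp only: set_sort set_map set_upt atLeastLessThanSuc_atLeastAtMost)
  finally show "a \<le> order_stat N u i" "order_stat N u i < b" using assms by auto
next
  show "mono_on {1..N} (order_stat N u)"
  proof (rule mono_onI)
    fix i j assume "i \<in> {1..N}" "j \<in> {1..N}" "i \<le> j"
    then have ij: "i - 1 \<le> j - 1" "j - 1 < length (sort (map u [1..<Suc N]))" by auto
    show "order_stat N u i \<le> order_stat N u j"
      unfolding order_stat_def by (rule sorted_nth_mono[OF sorted_sort ij])
  qed
qed

lemma admissible_cong: "(\<And>j. j \<in> {1..N} \<Longrightarrow> \<theta> j = \<theta>' j) \<Longrightarrow> admissible a b N \<theta> \<longleftrightarrow> admissible a b N \<theta>'"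
  unfolding admissible_def mono_on_def by (simp cong: conj_cong)

text \<open>This is \<open>N\<close> times the empirical distribution function at
  \<open>t\<close>.\<close>

definition count_le :: "nat \<Rightarrow> real \<Rightarrow> (nat \<Rightarrow> real) \<Rightarrow> real" where
  "count_le N t v = real (card {i \<in> {1..N}. v i \<le> t})"

lemma count_le_eq_sum: "count_le N t v = (\<Sum>i\<in>{1..N}. indicat_real {..t} (v i))"
proof -
  have "(\<Sum>i\<in>{1..N}. indicat_real {..t} (v i)) = (\<Sum>i\<in>{1..N}. if v i \<le> t then 1 else 0)"
    by (intro sum.cong) (simp_all add: indicator_def)
  also have "\<dots> = (\<Sum>i\<in>{i \<in> {1..N}. v i \<le> t}. 1)"
    by (intro sum.inter_filter[symmetric]) simp
  finally show ?thesis by (simp add: count_le_def)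
qed

lemma measurable_count_le [measurable]: "count_le N t \<in> borel_measurable (PiM {1..N} (\<lambda>_. borel))"
  unfolding count_le_eq_sum[abs_def] by measurable

lemma mono_on_iff_ball: "mono_on A f \<longleftrightarrow> (\<forall>i\<in>A. \<forall>j\<in>A. i \<le> j \<longrightarrow> f i \<le> f j)"
  unfolding mono_on_def by blast

lemma measurable_admissible:
  "{v \<in> space (PiM {1..N} (\<lambda>_. borel)). admissible a b N v} \<in> sets (PiM {1..N} (\<lambda>_. borel))"
proof -
  have "{v \<in> space (PiM {1..N} (\<lambda>_. borel)). a \<le> v i} \<in> sets (PiM {1..N} (\<lambda>_. borel))"
    if "i \<in> {1..N}" for i
    using that by measurable
  moreover have "{v \<in> space (PiM {1..N} (\<lambda>_. borel)). v i < b} \<in> sets (PiM {1..N} (\<lambda>_. borel))"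
    if "i \<in> {1..N}" for i
    using that by measurable
  moreover have "{v \<in> space (PiM {1..N} (\<lambda>_. borel)). (v i :: real) \<le> v j} \<in> sets (PiM {1..N} (\<lambda>_. borel))"
    if "i \<in> {1..N}" "j \<in> {1..N}" for i j
    using that by measurable
  ultimately show ?thesis
    unfolding admissible_def mono_on_iff_ball
    by (intro sets.sets_Collect_conj sets.sets_Collect_finite_All sets.sets_Collect_imp
        sets.sets_Collect_const finite_atLeastAtMost)
qed

context
  fixes a b :: real and N :: nat
  assumes ab: "a < b"
begin

abbreviation "unif \<equiv> uniform_measure lborel {a..b}"
abbreviation "sample \<equiv> PiM {1..N} (\<lambda>_. unif)"

lemma prob_space_unif: "prob_space unif"
  using ab by (intro prob_space_uniform_measure) auto

lemma sets_sample: "sets sample = sets (PiM {1..N} (\<lambda>_. borel))"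
  by (intro sets_PiM_cong) auto

lemma measurable_order_stats:
  "(\<lambda>u. \<lambda>i\<in>{1..N}. order_stat N u i) \<in> measurable sample (PiM {1..N} (\<lambda>_. borel))"
proof (rule measurable_restrict)
  fix i assume i: "i \<in> {1..N}"
  show "(\<lambda>u. order_stat N u i) \<in> borel_measurable sample"
    unfolding borel_measurable_iff_le
  proof
    fix t
    have "{u \<in> space sample. order_stat N u i \<le> t} = {u \<in> space sample. real i \<le> count_le N t u}"
      using order_stat_le_iff[OF i] by (simp add: count_le_def)
    moreover have "count_le N t \<in> borel_measurable sample"
      using measurable_count_le by (simp add: measurable_cong_sets[OF sets_sample refl])
    ultimately show "{u \<in> space sample. order_stat N u i \<le> t} \<in> sets sample" by simp
  qed
qed

lemma AE_order_stats_admissible: "AE v in uniform_order_stats_law a b N. admissible a b N v"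
proof -
  \<comment> \<open>The uniform law lives on the closed interval; the endpoint \<open>b\<close> is
    removed as a null set to match the half-open range of \<open>admissible\<close>.\<close>
  have "AE x in unif. a \<le> x \<and> x < b"
    using AE_lborel_singleton[of b] by (intro AE_uniform_measureI) auto
  then have "AE u in sample. \<forall>j\<in>{1..N}. a \<le> u j \<and> u j < b"
    by (intro AE_finite_allI AE_PiM_component prob_space_unif) auto
  then have "AE u in sample. admissible a b N (\<lambda>i\<in>{1..N}. order_stat N u i)"
  proof eventually_elim
    case (elim u)
    then have "admissible a b N (order_stat N u)" by (intro admissible_order_stat) auto
    then show ?case by (subst admissible_cong[where \<theta>' = "order_stat N u"]) auto
  qed
  then show ?thesis
    unfolding uniform_order_stats_law_def
    by (subst AE_distr_iff[OF measurable_order_stats measurable_admissible])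
qed

text \<open>Centred indicators are bounded by 1, so \<open>indep_sum_deviation\<close> applies with
  moment order 3 and bound 1. This is the source of \<open>28 = 16 + 3 * 2^2\<close>, of
  \<open>4 = 2 * (1 + 1)\<close> and of the exponent \<open>1 - 3\<close>.\<close>

lemma order_stats_deviation:
  fixes t \<delta> :: real
  assumes t: "a < t" "t < b" and \<delta>: "0 < \<delta>" and N: "0 < N" "4 \<le> \<delta> * N"
  shows "measure (uniform_order_stats_law a b N)
      {v \<in> space (PiM {1..N} (\<lambda>_. borel)). \<delta> * N < \<bar>count_le N t v - N * ((t - a) / (b - a))\<bar>}
    \<le> (1 + (2 / \<delta>) ^ 4 * 28) * N powr - 2"
proof -
  define q where "q = (t - a) / (b - a)"
  interpret S: prob_space sample by (intro prob_space_PiM prob_space_unif)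
  define Y where "Y i u = indicat_real {..t} (u i) - q" for i :: nat and u :: "nat \<Rightarrow> real"
  have q: "0 \<le> q" "q \<le> 1" using t by (auto simp: q_def field_simps)
  have Yb: "\<bar>Y i u\<bar> \<le> 1" for i u using q by (auto simp: Y_def indicator_def)
  have comp: "distr sample unif (\<lambda>u. u i) = unif" if "i \<in> {1..N}" for i
    using distr_PiM_component[of "{1..N}" "\<lambda>_. unif" i] prob_space_unif that by blast
  \<comment> \<open>The joint law of the coordinates is the product measure itself, which is the
    criterion for independence.\<close>
  have coord: "S.indep_vars (\<lambda>_. unif) (\<lambda>i u. u i) {1..N}"
  proof (subst S.indep_vars_iff_distr_eq_PiM')
    have "distr sample sample (\<lambda>u. \<lambda>i\<in>{1..N}. u i) = distr sample sample (\<lambda>u. u)"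
      by (intro distr_cong) (auto simp: space_PiM PiE_def extensional_restrict)
    also have "\<dots> = sample" by (rule distr_id)
    also have "\<dots> = PiM {1..N} (\<lambda>i. distr sample unif (\<lambda>u. u i))"
      by (intro PiM_cong refl comp[symmetric])
    finally show "distr sample sample (\<lambda>u. \<lambda>i\<in>{1..N}. u i) = PiM {1..N} (\<lambda>i. distr sample unif (\<lambda>u. u i))" .
  qed (use N in \<open>auto intro!: measurable_component_singleton\<close>)
  have ind: "S.indep_vars (\<lambda>_. borel) Y {1..N}"
    unfolding Y_def by (rule S.indep_vars_compose2[OF coord]) measurable
  have Ym: "Y i \<in> borel_measurable sample" if "i \<in> {1..N}" for i
    using ind that unfolding S.indep_vars_def by blast
  have Yi: "integrable sample (Y i)" if "i \<in> {1..N}" for i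
    by (rule S.integrable_real_bounded[OF Ym[OF that] Yb])
  have mean: "S.expectation (Y i) = 0" if i: "i \<in> {1..N}" for i
  proof -
    interpret U: prob_space unif by (rule prob_space_unif)
    have U1: "measure unif UNIV = 1" using U.prob_space by simp
    have "{a..b} \<inter> {..t} = {a..t}" using t by auto
    then have "measure unif {..t} = q"
      using ab t unfolding q_def by (subst measure_uniform_measure) auto
    then have "(\<integral>x. indicat_real {..t} x - q \<partial>unif) = 0"
      by (subst Bochner_Integration.integral_diff) (auto simp: U1 U.emeasure_eq_measure)
    moreover have "S.expectation (Y i) = (\<integral>x. indicat_real {..t} x - q \<partial>distr sample unif (\<lambda>u. u i))"
      unfolding Y_def using i by (subst integral_distr) auto
    ultimately show ?thesis by (simp only: comp[OF i])
  qed
  have Yp: "\<bar>Y i u\<bar> powr 3 \<le> 1" for i u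
    using powr_mono2[of 3 "\<bar>Y i u\<bar>" 1] Yb by simp
  have Ypi: "integrable sample (\<lambda>u. \<bar>Y i u\<bar> powr 3)" if "i \<in> {1..N}" for i
    using Ym[OF that] Yp by (intro S.integrable_real_bounded[where K = 1]) auto
  have YpB: "S.expectation (\<lambda>u. \<bar>Y i u\<bar> powr 3) \<le> 1" if "i \<in> {1..N}" for i
  proof -
    have "S.expectation (\<lambda>u. \<bar>Y i u\<bar> powr 3) \<le> S.expectation (\<lambda>_. 1)"
      by (intro integral_mono Ypi[OF that] Yp S.integrable_const)
    then show ?thesis by (simp only: lebesgue_integral_const S.prob_space real_scaleR_def mult_1)
  qed
  let ?A = "{v \<in> space (PiM {1..N} (\<lambda>_. borel)). \<delta> * N < \<bar>count_le N t v - N * q\<bar>}"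
  have A: "?A \<in> sets (PiM {1..N} (\<lambda>_. borel))" by measurable
  have cnt: "count_le N t (\<lambda>i\<in>{1..N}. order_stat N u i) - N * q = (\<Sum>i\<in>{1..N}. Y i u)" for u
  proof -
    have "count_le N t (\<lambda>i\<in>{1..N}. order_stat N u i) = count_le N t u"
      unfolding count_le_def using card_order_stat_le[of N u t] by (simp cong: conj_cong)
    then show ?thesis by (simp add: count_le_eq_sum Y_def sum_subtractf)
  qed
  have "measure (uniform_order_stats_law a b N) ?A
      = S.prob ((\<lambda>u. \<lambda>i\<in>{1..N}. order_stat N u i) -` ?A \<inter> space sample)"
    unfolding uniform_order_stats_law_def by (rule measure_distr[OF measurable_order_stats A])
  also have "(\<lambda>u. \<lambda>i\<in>{1..N}. order_stat N u i) -` ?A \<inter> space sample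
      = {u \<in> space sample. \<delta> * N < \<bar>\<Sum>i\<in>{1..N}. Y i u\<bar>}"
    using measurable_space[OF measurable_order_stats] cnt by auto
  also have "S.prob \<dots> \<le> (1 + (2 / \<delta>) ^ 4 * (16 * 1 + 3 * (1 + 1)\<^sup>2)) * N powr (1 - 3)"
  proof (rule S.indep_sum_deviation)
    show "finite {1..N}" "card {1..N} \<le> N" "2 \<le> (3 :: real)" "3 \<le> (3 :: real)" "0 \<le> (1 :: real)"
      "2 * (1 + 1) \<le> \<delta> * real N" using N by auto
  qed (fact ind Yi mean Ypi YpB \<delta> N(1))+
  finally show ?thesis by (simp add: q_def)
qed

end

section \<open>Concentration and limit of the conditional mean\<close>

context local_observable
begin

lemma cexp_X_fun:
  assumes \<theta>: "admissible a b N \<theta>" and kN: "k \<le> N"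
  shows "cexp N \<theta> (X_fun k g \<phi> N)
    = 1 / real N * (\<Sum>i=0..N - k. cexp N \<theta> (tau i g) * \<phi> (real i / real (N + 1)))"
proof -
  have I: "integrable (config_law N \<theta>) (\<lambda>e. tau i g e * \<phi> (real i / real (N + 1)))" if "i \<in> {0..N - k}" for i
    using that kN by (intro integrable_mult_left integrable_tau[OF \<theta>]) auto
  have "cexp N \<theta> (X_fun k g \<phi> N) = 1 / real N * measure_pmf.expectation (config_law N \<theta>)
      (\<lambda>e. \<Sum>i=0..N - k. tau i g e * \<phi> (real i / real (N + 1)))"
    unfolding cexp_def X_fun_def by (rule integral_mult_right_zero)
  also have "measure_pmf.expectation (config_law N \<theta>) (\<lambda>e. \<Sum>i=0..N - k. tau i g e * \<phi> (real i / real (N + 1)))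
      = (\<Sum>i=0..N - k. measure_pmf.expectation (config_law N \<theta>) (\<lambda>e. tau i g e * \<phi> (real i / real (N + 1))))"
    by (rule Bochner_Integration.integral_sum[OF I])
  finally show ?thesis by (simp add: cexp_def)
qed

lemma X_fun_deviation:
  assumes \<theta>: "admissible a b N \<theta>" and kN: "k \<le> N" and \<Phi>: "\<And>x. x \<in> {0..1} \<Longrightarrow> \<bar>\<phi> x\<bar> \<le> \<Phi>"
    and \<delta>: "0 < \<delta>" and N: "2 * (1 + \<Phi> powr p * B) \<le> \<delta> / k * N"
  shows "measure_pmf.prob (config_law N \<theta>) {e. \<delta> < \<bar>X_fun k g \<phi> N e - cexp N \<theta> (X_fun k g \<phi> N)\<bar>}
    \<le> k * (\<Phi> powr p * B + (2 / (\<delta> / k)) ^ 4 * (16 * (\<Phi> powr p * B) + 3 * (1 + \<Phi> powr p * B)\<^sup>2))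
      * N powr (1 - p)"
proof -
  let ?c = "\<lambda>i. \<phi> (real i / real (N + 1))"
  have N0: "0 < real N" using k kN by simp
  have "X_fun k g \<phi> N e - cexp N \<theta> (X_fun k g \<phi> N)
      = (\<Sum>i=0..N - k. ?c i * (tau i g e - cexp N \<theta> (tau i g))) / N" for e
    unfolding cexp_X_fun[OF \<theta> kN] unfolding X_fun_def
    by (simp add: right_diff_distrib sum_subtractf diff_divide_distrib mult.commute)
  then have "\<delta> < \<bar>X_fun k g \<phi> N e - cexp N \<theta> (X_fun k g \<phi> N)\<bar>
      \<longleftrightarrow> \<delta> * N < \<bar>\<Sum>i=0..N - k. ?c i * (tau i g e - cexp N \<theta> (tau i g))\<bar>" for e
    using N0 by (simp add: pos_less_divide_eq)
  moreover have "\<bar>?c i\<bar> \<le> \<Phi>" if "i \<le> N - k" for i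
    using that by (intro \<Phi>) auto
  ultimately show ?thesis
    using conditional_deviation[OF \<theta> kN _ \<delta> N, of ?c] by simp
qed

text \<open>A deterministic statement about one sequence of parameter vectors, to be applied to each
  realization outside a null set. In the limit all \<open>k\<close> parameters of the window at
  \<open>x\<close> equal \<open>rho a b x\<close>.\<close>

lemma cexp_X_fun_tendsto:
  assumes \<theta>: "\<And>N. 1 \<le> N \<Longrightarrow> admissible a b N (\<theta> N)"
    and cdf: "\<And>q. q \<in> \<rat> \<Longrightarrow> a < q \<Longrightarrow> q < b \<Longrightarrow>
      (\<lambda>N. count_le N q (\<theta> N) / N) \<longlonglongrightarrow> (q - a) / (b - a)"
    and cont: "continuous_on {0..1} \<phi>" and \<Phi>: "\<And>x. x \<in> {0..1} \<Longrightarrow> \<bar>\<phi> x\<bar> \<le> \<Phi>"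
  shows "(\<lambda>N. cexp N (\<theta> N) (X_fun k g \<phi> N)) \<longlonglongrightarrow> (LBINT x:{0..1}. h_fun k g (rho a b x) * \<phi> x)"
proof -
  define K where "K = \<bar>g (\<lambda>_. 0)\<bar> + (2 + (1 + b) ^ k * B)"
  \<comment> \<open>Padding by 0 turns the \<open>N - k + 1\<close> terms into a full average over
    \<open>N\<close> cells. For fixed \<open>x < 1\<close> the index at \<open>x\<close> eventually
    leaves the padded range.\<close>
  define u where "u N i = (if k \<le> N \<and> i \<le> N - k
      then cexp k (\<lambda>j. \<theta> N (i + j)) g * \<phi> (real i / real (N + 1)) else 0)" for N i
  have adm: "admissible a b k (\<lambda>j. \<theta> N (i + j))" if "k \<le> N" "i \<le> N - k" for N i
    using that k by (intro admissible_shift[OF \<theta>]) auto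
  have \<Phi>0: "0 \<le> \<Phi>" using \<Phi>[of 0] by simp
  have K0: "0 \<le> K" using B_nonneg a ab by (simp add: K_def)
  have "\<bar>u N i\<bar> \<le> K * \<Phi>" for N i
  proof (cases "k \<le> N \<and> i \<le> N - k")
    case True
    then have "real i / real (N + 1) \<in> {0..1}" by auto
    then show ?thesis
      using True mean_bounded[OF adm[of N i]] \<Phi> K0
      by (auto simp: u_def abs_mult K_def[symmetric] intro!: mult_mono)
  next
    case False
    then have "u N i = 0" unfolding u_def by (rule if_not_P)
    then show ?thesis using K0 \<Phi>0 by simp
  qed
  moreover have "(\<lambda>N. u N (nat \<lfloor>x * real N\<rfloor>)) \<longlonglongrightarrow> h_fun k g (rho a b x) * \<phi> x" if x: "0 \<le> x" "x < 1" for x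
  proof -
    define n where "n N = nat \<lfloor>x * real N\<rfloor>" for N
    have xN: "0 \<le> x * real N" for N using x by simp
    have n: "real (n N) \<le> x * N" for N
      unfolding n_def by (rule nat_floor_bounds(1)[OF xN])
    have "\<forall>\<^sub>F N in sequentially. real k \<le> (1 - x) * real N"
      using x by (intro eventually_le_mult_real) simp
    then have ev: "\<forall>\<^sub>F N in sequentially. k \<le> N \<and> n N \<le> N - k"
    proof (rule eventually_mono)
      fix N assume "real k \<le> (1 - x) * real N"
      then have "real (n N) + real k \<le> real N" using n[of N] by (simp add: algebra_simps)
      then have "n N + k \<le> N" by linarith
      then show "k \<le> N \<and> n N \<le> N - k" by simp
    qed
    have "0 \<le> (b - a) * x" "(b - a) * x < b - a" using ab x by simp_all
    then have r: "a \<le> rho a b x" "rho a b x < b" unfolding rho_def by linarith+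
    \<comment> \<open>For the finitely many \<open>N\<close> whose window does not fit, the constant
      vector keeps \<open>v N\<close> admissible without affecting the limit.\<close>
    define v where "v N = (if k \<le> N \<and> n N \<le> N - k then (\<lambda>j. \<theta> N (n N + j)) else (\<lambda>_. rho a b x))" for N
    have "(\<lambda>N. cexp k (v N) g) \<longlonglongrightarrow> h_fun k g (rho a b x)"
    proof (rule cexp_tendsto_h[OF _ r])
      show "admissible a b k (v N)" for N
        using adm[of N "n N"] admissible_const[OF r] by (simp add: v_def)
      fix j assume "j \<in> {1..k}"
      then have "(\<lambda>N. \<theta> N (n N + j)) \<longlonglongrightarrow> rho a b x"
        unfolding n_def using x
        by (intro empirical_quantile_tendsto[OF ab \<theta> cdf[unfolded count_le_def]]) auto
      moreover have "\<forall>\<^sub>F N in sequentially. \<theta> N (n N + j) = v N j"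
        using ev by eventually_elim (simp add: v_def)
      ultimately show "(\<lambda>N. v N j) \<longlonglongrightarrow> rho a b x"
        by (rule Lim_transform_eventually)
    qed
    moreover have "(\<lambda>N. \<phi> (real (n N) / real (N + 1))) \<longlonglongrightarrow> \<phi> x"
    proof (rule continuous_on_tendsto_compose[OF cont])
      show "(\<lambda>N. real (n N) / real (N + 1)) \<longlonglongrightarrow> x"
        unfolding n_def using x by (intro floor_quotient_tendsto) auto
      show "\<forall>\<^sub>F N in sequentially. real (n N) / real (N + 1) \<in> {0..1}"
        using ev by eventually_elim auto
    qed (use x in auto)
    ultimately have "(\<lambda>N. cexp k (v N) g * \<phi> (real (n N) / real (N + 1))) \<longlonglongrightarrow> h_fun k g (rho a b x) * \<phi> x"
      by (rule tendsto_mult)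
    moreover have "\<forall>\<^sub>F N in sequentially. cexp k (v N) g * \<phi> (real (n N) / real (N + 1)) = u N (n N)"
      using ev by eventually_elim (simp add: v_def u_def)
    ultimately show ?thesis unfolding n_def[symmetric] by (rule Lim_transform_eventually)
  qed
  ultimately have lim: "(\<lambda>N. (\<Sum>i<N. u N i) / N) \<longlonglongrightarrow> (LBINT x:{0..1}. h_fun k g (rho a b x) * \<phi> x)"
    by (rule averages_tendsto_integral)
  have "\<forall>\<^sub>F N in sequentially. (\<Sum>i<N. u N i) / N = cexp N (\<theta> N) (X_fun k g \<phi> N)"
    using eventually_ge_at_top[of k]
  proof (rule eventually_mono)
    fix N assume kN: "k \<le> N"
    then have N: "1 \<le> N" using k by simp
    have "(\<Sum>i<N. u N i) = (\<Sum>i=0..N - k. u N i)"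
      using k N by (intro sum.mono_neutral_right) (auto simp: u_def)
    also have "\<dots> = (\<Sum>i=0..N - k. cexp N (\<theta> N) (tau i g) * \<phi> (real i / real (N + 1)))"
      using kN by (intro sum.cong refl) (simp add: u_def cexp_tau[OF local])
    finally show "(\<Sum>i<N. u N i) / N = cexp N (\<theta> N) (X_fun k g \<phi> N)"
      by (simp add: cexp_X_fun[OF \<theta>[OF N] kN])
  qed
  with lim show ?thesis by (rule Lim_transform_eventually)
qed

end

lemma X_fun_truncate_config:
  assumes "local_function k g" "k \<le> N"
  shows "X_fun k g \<phi> N (truncate_config N e) = X_fun k g \<phi> N e"
proof -
  have "tau i g (truncate_config N e) = tau i g e" if "i \<in> {0..N - k}" for i
    unfolding tau_def using that assms(2)
    by (intro assms(1)[unfolded local_function_def, rule_format]) (auto simp: truncate_config_def)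
  then show ?thesis by (simp add: X_fun_def)
qed

lemma powr_le_one_plus_powr:
  fixes y :: real
  assumes "0 \<le> y" "p \<le> q" "0 \<le> p"
  shows "y powr p \<le> 1 + y powr q"
proof (cases "y \<le> 1")
  case True
  then have "y powr p \<le> 1" using assms powr_mono2[of p y 1] by simp
  then show ?thesis by (simp add: add_increasing2)
next
  case False
  then have "y powr p \<le> y powr q" using assms by (intro powr_mono) auto
  then show ?thesis by simp
qed

theorem theorem5p1:
  fixes M :: "'a measure"
    and \<theta>\<^sub>L \<theta>\<^sub>R B \<epsilon> :: real
    and \<Theta> :: "nat \<Rightarrow> nat \<Rightarrow> 'a \<Rightarrow> real"
    and \<eta> :: "nat \<Rightarrow> nat \<Rightarrow> 'a \<Rightarrow> nat"
    and \<phi> \<phi>' :: "real \<Rightarrow> real"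
    and k :: nat
    and g :: "(nat \<Rightarrow> nat) \<Rightarrow> real"
  assumes "prob_space M"
    and "0 \<le> \<theta>\<^sub>L" and "\<theta>\<^sub>L < \<theta>\<^sub>R"
    and "\<And>N i. 1 \<le> N \<Longrightarrow> i \<in> {1..N} \<Longrightarrow> \<Theta> N i \<in> borel_measurable M"
    and "\<And>N i. 1 \<le> N \<Longrightarrow> i \<in> {1..N} \<Longrightarrow> \<eta> N i \<in> measurable M (count_space UNIV)"
    and "\<And>N. 1 \<le> N \<Longrightarrow> vec_law M N (\<Theta> N) = uniform_order_stats_law \<theta>\<^sub>L \<theta>\<^sub>R N"
    and "\<And>N. 1 \<le> N \<Longrightarrow> conditional_config_law M N (\<Theta> N) (\<eta> N)"
    and "\<And>x. x \<in> {0..1} \<Longrightarrow> (\<phi> has_real_derivative \<phi>' x) (at x within {0..1})"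
    and "bounded (\<phi>' ` {0..1})"
    and "1 \<le> k" and "local_function k g"
    and "\<epsilon> > 0"
    and moment: "\<And>N i \<theta>. k \<le> N \<Longrightarrow> i \<in> {0..N - k} \<Longrightarrow>
           (\<forall>j\<in>{1..N}. \<theta>\<^sub>L \<le> \<theta> j \<and> \<theta> j < \<theta>\<^sub>R) \<Longrightarrow> mono_on {1..N} \<theta> \<Longrightarrow>
           integrable (config_law N \<theta>)
             (\<lambda>e. \<bar>tau i g e - cexp N \<theta> (tau i g)\<bar> powr (2 + \<epsilon>)) \<and>
           cexp N \<theta> (\<lambda>e. \<bar>tau i g e - cexp N \<theta> (tau i g)\<bar> powr (2 + \<epsilon>)) \<le> B"
    and mean: "\<And>N \<theta>. k \<le> N \<Longrightarrow>
           (\<forall>j\<in>{1..N}. \<theta>\<^sub>L \<le> \<theta> j \<and> \<theta> j < \<theta>\<^sub>R) \<Longrightarrow> mono_on {1..N} \<theta> \<Longrightarrow>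
           integrable (config_law N \<theta>) g \<and> cexp N \<theta> g \<le> B"
  shows "AE \<omega> in M.
           (\<lambda>N. X_fun k g \<phi> N (\<lambda>j. \<eta> N j \<omega>))
             \<longlonglongrightarrow> (LBINT x:{0..1}. h_fun k g (rho \<theta>\<^sub>L \<theta>\<^sub>R x) * \<phi> x)"
proof -
  interpret prob_space M by fact
  note \<Theta>_meas = assms(4) and \<eta>_meas = assms(5) and \<Theta>_law = assms(6) and \<eta>_law = assms(7)
  \<comment> \<open>Above 2 for the summability of \<open>N powr (1 - p)\<close>, capped at 3 for
    the truncation estimate.\<close>
  define p where "p = 2 + min \<epsilon> 1"
  have p: "2 < p" "p \<le> 3" "p \<le> 2 + \<epsilon>" using \<open>\<epsilon> > 0\<close> by (auto simp: p_def)
  have tau0: "tau 0 g = g" by (simp add: tau_def fun_eq_iff)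
  \<comment> \<open>Lowering the moment order from \<open>2 + \<epsilon>\<close> to \<open>p\<close>
    turns the bound \<open>B\<close> into \<open>1 + B\<close>, through
    \<open>y powr p \<le> 1 + y powr (2 + \<epsilon>)\<close>.\<close>
  interpret local_observable \<theta>\<^sub>L \<theta>\<^sub>R p "1 + B" k g
  proof
    fix \<theta> assume \<theta>: "admissible \<theta>\<^sub>L \<theta>\<^sub>R k \<theta>"
    let ?y = "\<lambda>e. \<bar>g e - cexp k \<theta> g\<bar>"
    have mom: "integrable (config_law k \<theta>) (\<lambda>e. ?y e powr (2 + \<epsilon>))" "cexp k \<theta> (\<lambda>e. ?y e powr (2 + \<epsilon>)) \<le> B"
      using moment[of k 0 \<theta>] \<theta> by (auto simp: tau0 admissible_def)
    have le: "?y e powr p \<le> 1 + ?y e powr (2 + \<epsilon>)" for e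
      using p by (intro powr_le_one_plus_powr) auto
    have I: "integrable (config_law k \<theta>) (\<lambda>e. 1 + ?y e powr (2 + \<epsilon>))" using mom by simp
    show 1: "integrable (config_law k \<theta>) (\<lambda>e. ?y e powr p)"
      by (rule Bochner_Integration.integrable_bound[OF I]) (use le in \<open>auto intro!: AE_I2\<close>)
    have "cexp k \<theta> (\<lambda>e. ?y e powr p) \<le> cexp k \<theta> (\<lambda>e. 1 + ?y e powr (2 + \<epsilon>))"
      unfolding cexp_def[of _ _ "\<lambda>e. _ e powr p"] cexp_def[of _ _ "\<lambda>e. 1 + _ e"]
      by (intro integral_mono 1 I le)
    also have "\<dots> = 1 + cexp k \<theta> (\<lambda>e. ?y e powr (2 + \<epsilon>))"
      using mom(1) by (simp add: cexp_def measure_pmf.prob_space)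
    finally show "cexp k \<theta> (\<lambda>e. ?y e powr p) \<le> 1 + B" using mom(2) by simp
    show "integrable (config_law k \<theta>) g" using mean[of k \<theta>] \<theta> by (auto simp: admissible_def)
  qed (use assms p in auto)
  have cont: "continuous_on {0..1} \<phi>"
    using assms(8) by (meson DERIV_continuous_on)
  have "bounded (\<phi> ` {0..1})"
    by (intro compact_imp_bounded compact_continuous_image cont compact_Icc)
  then obtain \<Phi> where \<Phi>: "\<And>x. x \<in> {0..1} \<Longrightarrow> \<bar>\<phi> x\<bar> \<le> \<Phi>"
    unfolding bounded_iff real_norm_def by blast
  have k1: "1 \<le> N" if "k \<le> N" for N using that \<open>1 \<le> k\<close> by simp

  \<comment> \<open>Almost sure ordering and empirical distribution of the parameters\<close>
  have vec_meas: "(\<lambda>\<omega>. \<lambda>i\<in>{1..N}. \<Theta> N i \<omega>) \<in> measurable M (PiM {1..N} (\<lambda>_. borel))" if "1 \<le> N" for N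
    using \<Theta>_meas[OF that] by (intro measurable_restrict)
  have "AE \<omega> in M. admissible \<theta>\<^sub>L \<theta>\<^sub>R N (\<lambda>i. \<Theta> N i \<omega>)" if N: "1 \<le> N" for N
  proof -
    have "AE v in vec_law M N (\<Theta> N). admissible \<theta>\<^sub>L \<theta>\<^sub>R N v"
      unfolding \<Theta>_law[OF N] by (rule AE_order_stats_admissible[OF \<open>\<theta>\<^sub>L < \<theta>\<^sub>R\<close>])
    then have "AE \<omega> in M. admissible \<theta>\<^sub>L \<theta>\<^sub>R N (\<lambda>i\<in>{1..N}. \<Theta> N i \<omega>)"
      unfolding vec_law_def by (rule AE_distrD[OF vec_meas[OF N]])
    then show ?thesis
      by eventually_elim (subst admissible_cong[where \<theta>' = "\<lambda>i\<in>{1..N}. \<Theta> N i _"], auto)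
  qed
  then have adm: "AE \<omega> in M. \<forall>N. 1 \<le> N \<longrightarrow> admissible \<theta>\<^sub>L \<theta>\<^sub>R N (\<lambda>i. \<Theta> N i \<omega>)"
    unfolding AE_all_countable by (intro allI AE_impI) blast

  have "AE \<omega> in M. (\<lambda>N. count_le N q (\<lambda>i. \<Theta> N i \<omega>) / N - (q - \<theta>\<^sub>L) / (\<theta>\<^sub>R - \<theta>\<^sub>L)) \<longlonglongrightarrow> 0"
    if q: "\<theta>\<^sub>L < q" "q < \<theta>\<^sub>R" for q
  proof (rule AE_tendsto_zero_of_summable_tails)
    show "(\<lambda>\<omega>. count_le N q (\<lambda>i. \<Theta> N i \<omega>) / N - (q - \<theta>\<^sub>L) / (\<theta>\<^sub>R - \<theta>\<^sub>L)) \<in> borel_measurable M" for N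
    proof -
      have [measurable]: "\<Theta> N i \<in> borel_measurable M" if "i \<in> {1..N}" for i
        using that by (intro \<Theta>_meas) auto
      show ?thesis unfolding count_le_eq_sum by measurable
    qed
    fix \<delta> :: real assume \<delta>: "0 < \<delta>"
    let ?F = "(q - \<theta>\<^sub>L) / (\<theta>\<^sub>R - \<theta>\<^sub>L)"
    let ?s = "\<lambda>N. (1 + (2 / \<delta>) ^ 4 * 28) * real N powr - 2"
    have "summable ?s" by (intro summable_mult) (simp add: summable_real_powr_iff)
    moreover have "\<forall>\<^sub>F N in sequentially. prob {\<omega> \<in> space M. \<delta> < \<bar>count_le N q (\<lambda>i. \<Theta> N i \<omega>) / N - ?F\<bar>} \<le> ?s N"
      using eventually_le_mult_real[OF \<delta>, of 4] eventually_ge_at_top[of 1]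
    proof eventually_elim
      case (elim N)
      let ?A = "{v \<in> space (PiM {1..N} (\<lambda>_. borel)). \<delta> * N < \<bar>count_le N q v - N * ?F\<bar>}"
      have A: "?A \<in> sets (PiM {1..N} (\<lambda>_. borel))" by measurable
      have "\<delta> < \<bar>count_le N q (\<lambda>i. \<Theta> N i \<omega>) / N - ?F\<bar>
          \<longleftrightarrow> \<delta> * N < \<bar>count_le N q (\<lambda>i\<in>{1..N}. \<Theta> N i \<omega>) - N * ?F\<bar>" for \<omega>
      proof -
        have "count_le N q (\<lambda>i\<in>{1..N}. \<Theta> N i \<omega>) = count_le N q (\<lambda>i. \<Theta> N i \<omega>)"
          unfolding count_le_eq_sum by (intro sum.cong) auto
        moreover have "count_le N q (\<lambda>i. \<Theta> N i \<omega>) / N - ?F = (count_le N q (\<lambda>i. \<Theta> N i \<omega>) - N * ?F) / N"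
          using elim by (simp add: diff_divide_distrib)
        ultimately show ?thesis using elim by (simp only: abs_divide abs_of_nat) (simp add: pos_less_divide_eq)
      qed
      then have "{\<omega> \<in> space M. \<delta> < \<bar>count_le N q (\<lambda>i. \<Theta> N i \<omega>) / N - ?F\<bar>}
          = (\<lambda>\<omega>. \<lambda>i\<in>{1..N}. \<Theta> N i \<omega>) -` ?A \<inter> space M"
        using measurable_space[OF vec_meas[OF elim(2)]] by blast
      then have "prob {\<omega> \<in> space M. \<delta> < \<bar>count_le N q (\<lambda>i. \<Theta> N i \<omega>) / N - ?F\<bar>}
          = measure (vec_law M N (\<Theta> N)) ?A"
        unfolding vec_law_def by (simp only: measure_distr[OF vec_meas[OF elim(2)] A])
      also have "\<dots> \<le> ?s N"
        unfolding \<Theta>_law[OF elim(2)] using elim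
        by (intro order_stats_deviation[OF \<open>\<theta>\<^sub>L < \<theta>\<^sub>R\<close> q \<delta>]) auto
      finally show ?case .
    qed
    ultimately show "\<exists>s. summable s \<and> (\<forall>\<^sub>F N in sequentially.
        prob {\<omega> \<in> space M. \<delta> < \<bar>count_le N q (\<lambda>i. \<Theta> N i \<omega>) / N - ?F\<bar>} \<le> s N)"
      by blast
  qed
  \<comment> \<open>Rational levels allow one null set to serve all of them at once.\<close>
  then have cdf: "AE \<omega> in M. \<forall>q\<in>\<rat> \<inter> {\<theta>\<^sub>L<..<\<theta>\<^sub>R}.
      (\<lambda>N. count_le N q (\<lambda>i. \<Theta> N i \<omega>) / N - (q - \<theta>\<^sub>L) / (\<theta>\<^sub>R - \<theta>\<^sub>L)) \<longlonglongrightarrow> 0"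
    by (subst AE_ball_countable[OF countable_Int1[OF countable_rat]]) simp

  \<comment> \<open>Almost sure vanishing of the deviation from the conditional mean\<close>
  define cond_mean where "cond_mean N m \<longleftrightarrow> m \<in> borel_measurable M
      \<and> (\<lambda>\<omega>. X_fun k g \<phi> N (truncate_config N (\<lambda>i. \<eta> N i \<omega>))) \<in> borel_measurable M
      \<and> (AE \<omega> in M. m \<omega> = cexp N (\<lambda>i. \<Theta> N i \<omega>) (X_fun k g \<phi> N))
      \<and> (\<forall>\<delta>. \<forall>c\<ge>0. (AE \<omega> in M. measure_pmf.prob (config_law N (\<lambda>i. \<Theta> N i \<omega>))
            {x. \<delta> < \<bar>X_fun k g \<phi> N x - cexp N (\<lambda>i. \<Theta> N i \<omega>) (X_fun k g \<phi> N)\<bar>} \<le> c)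
          \<longrightarrow> prob {\<omega> \<in> space M. \<delta> < \<bar>X_fun k g \<phi> N (truncate_config N (\<lambda>i. \<eta> N i \<omega>)) - m \<omega>\<bar>} \<le> c)"
    for N and m :: "'a \<Rightarrow> real"
  have "\<exists>m. cond_mean N m" if N: "1 \<le> N" for N
    unfolding cond_mean_def
    by (rule conditional_config_law_deviation[OF \<Theta>_meas[OF N] \<eta>_meas[OF N] \<eta>_law[OF N],
          where f = "X_fun k g \<phi> N"]) (assumption, assumption, intro exI conjI)
  \<comment> \<open>A measurable version of the conditional mean exists for each size separately;
    choice assembles these into the sequence needed for Borel--Cantelli.\<close>
  then have "\<forall>N\<in>{1..}. \<exists>m. cond_mean N m" by simp
  from bchoice[OF this] obtain m where cond_mean: "\<And>N. 1 \<le> N \<Longrightarrow> cond_mean N (m N)" by auto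
  note m = cond_mean[unfolded cond_mean_def, THEN conjunct1]
    and X_meas = cond_mean[unfolded cond_mean_def, THEN conjunct2, THEN conjunct1]
    and m_eq = cond_mean[unfolded cond_mean_def, THEN conjunct2, THEN conjunct2, THEN conjunct1]
    and m_dev = cond_mean[unfolded cond_mean_def, THEN conjunct2, THEN conjunct2, THEN conjunct2, rule_format]
  \<comment> \<open>The model starts at size 1; the value 0 at \<open>N = 0\<close> keeps every
    \<open>D N\<close> measurable.\<close>
  define D where "D N \<omega> = (if 1 \<le> N then X_fun k g \<phi> N (truncate_config N (\<lambda>i. \<eta> N i \<omega>)) - m N \<omega> else 0)"
    for N \<omega>
  have D: "AE \<omega> in M. (\<lambda>N. D N \<omega>) \<longlonglongrightarrow> 0"
  proof (rule AE_tendsto_zero_of_summable_tails)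
    show "D N \<in> borel_measurable M" for N
      using borel_measurable_diff[OF X_meas m, of N] by (cases "1 \<le> N") (auto simp: D_def[abs_def])
    fix \<delta> :: real assume \<delta>: "0 < \<delta>"
    define C where "C = k * (\<Phi> powr p * (1 + B) + (2 / (\<delta> / k)) ^ 4
        * (16 * (\<Phi> powr p * (1 + B)) + 3 * (1 + \<Phi> powr p * (1 + B))\<^sup>2))"
    have C: "0 \<le> C" using B_nonneg \<delta> by (simp add: C_def)
    have "0 < \<delta> / k" using \<delta> \<open>1 \<le> k\<close> by simp
    have "summable (\<lambda>N. C * real N powr (1 - p))"
      using p by (intro summable_mult) (simp add: summable_real_powr_iff)
    moreover have "\<forall>\<^sub>F N in sequentially. prob {\<omega> \<in> space M. \<delta> < \<bar>D N \<omega>\<bar>} \<le> C * real N powr (1 - p)"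
      using eventually_le_mult_real[OF \<open>0 < \<delta> / k\<close>, of "2 * (1 + \<Phi> powr p * (1 + B))"]
        eventually_ge_at_top[of k]
    proof eventually_elim
      case (elim N)
      \<comment> \<open>The bound is the same for all admissible parameters, hence a deterministic
        bound on the conditional probability, which passes to the unconditional one.\<close>
      have "AE \<omega> in M. measure_pmf.prob (config_law N (\<lambda>i. \<Theta> N i \<omega>))
            {x. \<delta> < \<bar>X_fun k g \<phi> N x - cexp N (\<lambda>i. \<Theta> N i \<omega>) (X_fun k g \<phi> N)\<bar>} \<le> C * real N powr (1 - p)"
        using adm
      proof eventually_elim
        case (elim \<omega>)
        then show ?case
          unfolding C_def using k1 \<open>k \<le> N\<close> \<open>2 * (1 + \<Phi> powr p * (1 + B)) \<le> \<delta> / k * N\<close>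
          by (intro X_fun_deviation \<Phi> \<delta>) auto
      qed
      then show ?case
        using m_dev[OF k1[OF elim(2)]] C k1[OF elim(2)] by (simp add: D_def)
    qed
    ultimately show "\<exists>s. summable s \<and> (\<forall>\<^sub>F N in sequentially. prob {\<omega> \<in> space M. \<delta> < \<bar>D N \<omega>\<bar>} \<le> s N)"
      by blast
  qed
  have m_eq': "AE \<omega> in M. \<forall>N. 1 \<le> N \<longrightarrow> m N \<omega> = cexp N (\<lambda>i. \<Theta> N i \<omega>) (X_fun k g \<phi> N)"
    using m_eq unfolding AE_all_countable by (intro allI AE_impI) blast
  show ?thesis
    using adm cdf D m_eq'
  proof eventually_elim
    case (elim \<omega>)
    have mean_lim: "(\<lambda>N. cexp N (\<lambda>i. \<Theta> N i \<omega>) (X_fun k g \<phi> N))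
        \<longlonglongrightarrow> (LBINT x:{0..1}. h_fun k g (rho \<theta>\<^sub>L \<theta>\<^sub>R x) * \<phi> x)"
      using elim(1,2) by (intro cexp_X_fun_tendsto[OF _ _ cont \<Phi>]) (auto intro: LIM_zero_cancel)
    have "\<forall>\<^sub>F N in sequentially.
        D N \<omega> = X_fun k g \<phi> N (\<lambda>j. \<eta> N j \<omega>) - cexp N (\<lambda>i. \<Theta> N i \<omega>) (X_fun k g \<phi> N)"
      using eventually_ge_at_top[of k]
    proof (rule eventually_mono)
      fix N assume "k \<le> N"
      then show "D N \<omega> = X_fun k g \<phi> N (\<lambda>j. \<eta> N j \<omega>) - cexp N (\<lambda>i. \<Theta> N i \<omega>) (X_fun k g \<phi> N)"
        using elim(4) k1 X_fun_truncate_config[OF \<open>local_function k g\<close>] by (simp add: D_def)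
    qed
    then have "(\<lambda>N. X_fun k g \<phi> N (\<lambda>j. \<eta> N j \<omega>) - cexp N (\<lambda>i. \<Theta> N i \<omega>) (X_fun k g \<phi> N)) \<longlonglongrightarrow> 0"
      by (rule Lim_transform_eventually[OF elim(3)])
    from tendsto_add[OF this mean_lim] show ?case by simp
  qed
qed

end
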